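(* Let $\phi$ be a linear formula on a finite set of variables $\mathcal{V}_1$ and $\psi$ a linear formula on a finite set of variables $\mathcal{V}_2$, and suppose $\phi \to \psi$ is a linear inference. If $|\mathcal{V}_1 \cap \mathcal{V}_2| \leq 7$, then $\phi$ is $\{\mathsf{s},\mathsf{m}\}$-derivable with units to $\psi$. Furthermore, there exists a linear inference $\phi \to \psi$ on $8$ variables such that $\psi$ is not $\{\mathsf{s},\mathsf{m}\}$-derivable with units from $\phi$; hence $7$ is the largest number with the property above.
   Context: Fix a countably infinite set of variables. Linear formulae on a finite set $\mathcal{V}$ of variables are defined inductively: - $\top$ and $\bot$ are linear formulae on $\emptyset$. - For a variable $x$, both $x$ and $\neg x$ are linear formulae on $\{x\}$. - If $\phi$ is on $\mathcal{V}_1$, $\psi$ is on $\mathcal{V}_2$ and $\mathcal{V}_1 \cap \mathcal{V}_2 = \emptyset$, then $\phi \lor \psi$ and $\phi \land \psi$ are linear formulae on $\mathcal{V}_1 \cup \mathcal{V}_2$. Formulae are evaluated under assignments $\alpha$ from variables to $\{0,1\}$ in the usual Boolean way. A linear inference is a pair $\phi \to \psi$ of linear formulae, possibly on different variable sets, such that every assignment satisfying $\phi$ also satisfies $\psi$. An inference is on $n$ variables if both sides are linear formulae on a common set $\mathcal{V}$ with $|\mathcal{V}| = n$. A congruence is an equivalence relation on linear formulae closed under contexts: $\phi \sim \psi$ implies $\phi \land \chi \sim \psi\land\chi$, $\chi\land\phi\sim\chi\land\psi$, and the same for $\lor$. - $\sim_{\mathsf{ac}}$ is the smallest congruence containing commutativity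 and associativity of $\land$ and of $\lor$. - $\sim_{\mathsf{u}}$ is the smallest congruence containing $\phi\land\top\sim\phi$, $\top\land\phi\sim\phi$, $\phi\lor\bot\sim\phi$, $\bot\lor\phi\sim\phi$, $\phi\land\bot\sim\bot$, $\bot\land\phi\sim\bot$, $\phi\lor\top\sim\top$ and $\top\lor\phi\sim\top$. - $\sim_{\mathsf{acu}}$ is the smallest congruence containing both $\sim_{\mathsf{ac}}$ and $\sim_{\mathsf{u}}$. For a set $S$ of linear inferences, $\to_S$ is the smallest relation containing each inference of $S$ and closed under substitution of linear formulae for variables (keeping linearity) and under contexts. Write $\phi \rightsquigarrow_{S\mathsf{u}} \psi$ if there are $\phi',\psi'$ with $\phi \sim_{\mathsf{acu}} \phi' \to_S \psi' \sim_{\mathsf{acu}} \psi$. The inference $\phi\to\psi$ is $S$-derivable with units if $\phi$ and $\psi$ are related by the reflexive-transitive closure of $\rightsquigarrow_{S\mathsf{u}} \cup \sim_{\mathsf{acu}}$. Switch $\mathsf{s}$ is the inference $x \land (y \lor z) \to (x\land y)\lor z$, and medial $\mathsf{m}$ is the inference $(w\land x)\lor(y\land z) \to (w\lor y)\land(x\lor z)$. *)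

theory Defs
  imports Main
begin

datatype lform = Top | Bot | Var nat | NVar nat | And lform lform | Or lform lform

fun vars :: "lform \<Rightarrow> nat set" where
  "vars Top = {}" | "vars Bot = {}" | "vars (Var x) = {x}" | "vars (NVar x) = {x}"
| "vars (And a b) = vars a \<union> vars b" | "vars (Or a b) = vars a \<union> vars b"

fun linear :: "lform \<Rightarrow> bool" where
  "linear (And a b) = (linear a \<and> linear b \<and> vars a \<inter> vars b = {})"
| "linear (Or a b) = (linear a \<and> linear b \<and> vars a \<inter> vars b = {})"
| "linear _ = True"

fun eval :: "(nat \<Rightarrow> bool) \<Rightarrow> lform \<Rightarrow> bool" where
  "eval \<alpha> Top = True" | "eval \<alpha> Bot = False" | "eval \<alpha> (Var x) = \<alpha> x"
| "eval \<alpha> (NVar x) = (\<not> \<alpha> x)"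
| "eval \<alpha> (And a b) = (eval \<alpha> a \<and> eval \<alpha> b)"
| "eval \<alpha> (Or a b) = (eval \<alpha> a \<or> eval \<alpha> b)"

definition linear_inference :: "lform \<Rightarrow> lform \<Rightarrow> bool" where
  "linear_inference \<phi> \<psi> \<longleftrightarrow> linear \<phi> \<and> linear \<psi> \<and> (\<forall>\<alpha>. eval \<alpha> \<phi> \<longrightarrow> eval \<alpha> \<psi>)"

fun neg :: "lform \<Rightarrow> lform" where
  "neg Top = Bot" | "neg Bot = Top" | "neg (Var x) = NVar x" | "neg (NVar x) = Var x"
| "neg (And a b) = Or (neg a) (neg b)" | "neg (Or a b) = And (neg a) (neg b)"

fun subst :: "(nat \<Rightarrow> lform) \<Rightarrow> lform \<Rightarrow> lform" where
  "subst \<sigma> Top = Top" | "subst \<sigma> Bot = Bot" | "subst \<sigma> (Var x) = \<sigma> x"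
| "subst \<sigma> (NVar x) = neg (\<sigma> x)"
| "subst \<sigma> (And a b) = And (subst \<sigma> a) (subst \<sigma> b)"
| "subst \<sigma> (Or a b) = Or (subst \<sigma> a) (subst \<sigma> b)"

definition switch :: "lform \<times> lform" where
  "switch = (And (Var 0) (Or (Var 1) (Var 2)), Or (And (Var 0) (Var 1)) (Var 2))"

definition medial :: "lform \<times> lform" where
  "medial = (Or (And (Var 0) (Var 1)) (And (Var 2) (Var 3)),
             And (Or (Var 0) (Var 2)) (Or (Var 1) (Var 3)))"

inductive step :: "(lform \<times> lform) set \<Rightarrow> lform \<Rightarrow> lform \<Rightarrow> bool" for S where
  inst: "(l, r) \<in> S \<Longrightarrow> linear (subst \<sigma> l) \<Longrightarrow> linear (subst \<sigma> r)
         \<Longrightarrow> step S (subst \<sigma> l) (subst \<sigma> r)"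
| and_l: "step S a b \<Longrightarrow> linear (And a c) \<Longrightarrow> linear (And b c) \<Longrightarrow> step S (And a c) (And b c)"
| and_r: "step S a b \<Longrightarrow> linear (And c a) \<Longrightarrow> linear (And c b) \<Longrightarrow> step S (And c a) (And c b)"
| or_l: "step S a b \<Longrightarrow> linear (Or a c) \<Longrightarrow> linear (Or b c) \<Longrightarrow> step S (Or a c) (Or b c)"
| or_r: "step S a b \<Longrightarrow> linear (Or c a) \<Longrightarrow> linear (Or c b) \<Longrightarrow> step S (Or c a) (Or c b)"

inductive acu :: "lform \<Rightarrow> lform \<Rightarrow> bool" where
  refl: "linear a \<Longrightarrow> acu a a"
| sym: "acu a b \<Longrightarrow> acu b a"
| trans: "acu a b \<Longrightarrow> acu b c \<Longrightarrow> acu a c"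
| and_comm: "linear (And a b) \<Longrightarrow> acu (And a b) (And b a)"
| or_comm: "linear (Or a b) \<Longrightarrow> acu (Or a b) (Or b a)"
| and_assoc: "linear (And a (And b c)) \<Longrightarrow> acu (And a (And b c)) (And (And a b) c)"
| or_assoc: "linear (Or a (Or b c)) \<Longrightarrow> acu (Or a (Or b c)) (Or (Or a b) c)"
| and_top_r: "linear a \<Longrightarrow> acu (And a Top) a"
| and_top_l: "linear a \<Longrightarrow> acu (And Top a) a"
| or_bot_r: "linear a \<Longrightarrow> acu (Or a Bot) a"
| or_bot_l: "linear a \<Longrightarrow> acu (Or Bot a) a"
| and_bot_r: "linear a \<Longrightarrow> acu (And a Bot) Bot"
| and_bot_l: "linear a \<Longrightarrow> acu (And Bot a) Bot"
| or_top_r: "linear a \<Longrightarrow> acu (Or a Top) Top"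
| or_top_l: "linear a \<Longrightarrow> acu (Or Top a) Top"
| ctx_and_l: "acu a b \<Longrightarrow> linear (And a c) \<Longrightarrow> linear (And b c) \<Longrightarrow> acu (And a c) (And b c)"
| ctx_and_r: "acu a b \<Longrightarrow> linear (And c a) \<Longrightarrow> linear (And c b) \<Longrightarrow> acu (And c a) (And c b)"
| ctx_or_l: "acu a b \<Longrightarrow> linear (Or a c) \<Longrightarrow> linear (Or b c) \<Longrightarrow> acu (Or a c) (Or b c)"
| ctx_or_r: "acu a b \<Longrightarrow> linear (Or c a) \<Longrightarrow> linear (Or c b) \<Longrightarrow> acu (Or c a) (Or c b)"

definition step_u :: "(lform \<times> lform) set \<Rightarrow> lform \<Rightarrow> lform \<Rightarrow> bool" where
  "step_u S \<phi> \<psi> \<longleftrightarrow> (\<exists>\<phi>' \<psi>'. acu \<phi> \<phi>' \<and> step S \<phi>' \<psi>' \<and> acu \<psi>' \<psi>)"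

definition derivable_units :: "(lform \<times> lform) set \<Rightarrow> lform \<Rightarrow> lform \<Rightarrow> bool" where
  "derivable_units S \<phi> \<psi> \<longleftrightarrow> (\<lambda>a b. step_u S a b \<or> acu a b)\<^sup>*\<^sup>* \<phi> \<psi>"

end

theory Submission
  imports Defs
begin

text \<open>Variables that are missing on one side, or occur with different polarities, are replaced by units
  through weakening. If \<open>\<psi> = \<psi>1 \<and> \<psi>2\<close>, iterated medial derives from \<open>\<phi>\<close> the conjunction of its
  restrictions to the variables of \<open>\<psi>1\<close> and of \<open>\<psi>2\<close>, which leaves two smaller inferences; dually if
  \<open>\<phi>\<close> is a disjunction. So \<open>\<phi> = \<And>i \<Or>j D i j\<close> and \<open>\<psi> = \<Or>k \<And>l E k l\<close>, and literals among the conjuncts of \<open>\<phi>\<close>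
  or the disjuncts of \<open>\<psi>\<close> can be split off by switch. If some \<open>D i j\<close> implies \<open>\<psi>\<close>, one switch turns \<open>\<phi>\<close>
  into a disjunction that still implies \<open>\<psi>\<close>; dually if \<open>\<phi>\<close> implies some \<open>E k l\<close>. One of the two always
  happens on at most seven variables: there are two or three conjuncts of at least two variables each,
  the case of two is excluded by looking at small minterms, and in the case of three conjuncts and three
  disjuncts the sizes are 2, 2 and at most 3, where counting pairs gives a minterm of \<open>\<phi>\<close> falsifying \<open>\<psi>\<close>.

  For eight variables, whether two variables meet at a conjunction or at a disjunction can be read off
  from the truth table. For formulae between the two sides of the example, the relation
  of the pair \<open>3, 7\<close> determines that of \<open>1, 2\<close> in the opposite way, whereas switch only turns
  conjunctive pairs into disjunctive ones and medial does the reverse.\<close>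

section \<open>Derivations\<close>

abbreviation (input) SM :: "(lform \<times> lform) set" where "SM \<equiv> {switch, medial}"

text \<open>The laws that absorb a formula into a unit, read backwards, bring in arbitrary
  variables, and these could clash with a surrounding context. Hence every move is confined to
  \<open>V\<close>.\<close>

definition move :: "nat set \<Rightarrow> lform \<Rightarrow> lform \<Rightarrow> bool" where
  "move V a b \<longleftrightarrow> linear a \<and> linear b \<and> vars a \<subseteq> V \<and> vars b \<subseteq> V \<and> (acu a b \<or> step SM a b)"

text \<open>Derivations whose intermediate formulae stay on the variables \<open>V\<close>: unlike
  \<^const>\<open>derivable_units\<close>, this relation is closed under contexts on variables outside \<open>V\<close>.\<close>

definition deriv_on :: "nat set \<Rightarrow> lform \<Rightarrow> lform \<Rightarrow> bool" where
  "deriv_on V = (move V)\<^sup>*\<^sup>*"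

declare acu.trans [trans]

lemma acu_linear: "acu a b \<Longrightarrow> linear a \<and> linear b"
  by (induction rule: acu.induct) auto

lemma step_linear: "step S a b \<Longrightarrow> linear a \<and> linear b"
  by (induction rule: step.induct) auto

lemma deriv_on_refl [simp]: "deriv_on V a a"
  by (simp add: deriv_on_def)

lemma deriv_on_trans [trans]: "deriv_on V a b \<Longrightarrow> deriv_on V b c \<Longrightarrow> deriv_on V a c"
  unfolding deriv_on_def by auto

lemma move_mono: "move V a b \<Longrightarrow> V \<subseteq> W \<Longrightarrow> move W a b"
  unfolding move_def by (meson subset_trans)

lemma deriv_on_mono: "deriv_on V a b \<Longrightarrow> V \<subseteq> W \<Longrightarrow> deriv_on W a b"
  unfolding deriv_on_def by (erule rtranclp_mono[THEN predicate2D, rotated]) (use move_mono in blast)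

lemma deriv_on_acu: "acu a b \<Longrightarrow> vars a \<subseteq> V \<Longrightarrow> vars b \<subseteq> V \<Longrightarrow> deriv_on V a b"
  unfolding deriv_on_def by (rule r_into_rtranclp) (auto simp: move_def dest: acu_linear)

lemma deriv_on_step: "step SM a b \<Longrightarrow> vars a \<subseteq> V \<Longrightarrow> vars b \<subseteq> V \<Longrightarrow> deriv_on V a b"
  unfolding deriv_on_def by (rule r_into_rtranclp) (auto simp: move_def dest: step_linear)

lemma derivable_units_of_deriv_on:
  assumes "deriv_on V a b" shows "derivable_units SM a b"
  using assms unfolding deriv_on_def derivable_units_def
proof (rule rtranclp_mono[THEN predicate2D, rotated], intro le_funI le_boolI)
  fix x y assume m: "move V x y"
  then have "acu x x" "acu y y" by (auto simp: move_def intro: acu.refl)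
  with m show "step_u SM x y \<or> acu x y" unfolding move_def step_u_def by blast
qed

section \<open>Closure under contexts\<close>

lemma deriv_on_And_l:
  assumes "deriv_on V a b" "linear c" "vars c \<inter> V = {}"
  shows "deriv_on (V \<union> vars c) (And a c) (And b c)"
  using assms(1) unfolding deriv_on_def
proof (induction rule: rtranclp_induct)
  case (step y z)
  have "move (V \<union> vars c) (And y c) (And z c)"
    using step(2) assms(2,3) unfolding move_def
    by (auto intro!: step.and_l acu.ctx_and_l; blast)
  with step show ?case by simp
qed simp

lemma deriv_on_And_r:
  assumes "deriv_on V a b" "linear c" "vars c \<inter> V = {}"
  shows "deriv_on (V \<union> vars c) (And c a) (And c b)"
  using assms(1) unfolding deriv_on_def
proof (induction rule: rtranclp_induct)
  case (step y z)
  have "move (V \<union> vars c) (And c y) (And c z)"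
    using step(2) assms(2,3) unfolding move_def
    by (auto intro!: step.and_r acu.ctx_and_r; blast)
  with step show ?case by simp
qed simp

lemma deriv_on_Or_l:
  assumes "deriv_on V a b" "linear c" "vars c \<inter> V = {}"
  shows "deriv_on (V \<union> vars c) (Or a c) (Or b c)"
  using assms(1) unfolding deriv_on_def
proof (induction rule: rtranclp_induct)
  case (step y z)
  have "move (V \<union> vars c) (Or y c) (Or z c)"
    using step(2) assms(2,3) unfolding move_def
    by (auto intro!: step.or_l acu.ctx_or_l; blast)
  with step show ?case by simp
qed simp

lemma deriv_on_Or_r:
  assumes "deriv_on V a b" "linear c" "vars c \<inter> V = {}"
  shows "deriv_on (V \<union> vars c) (Or c a) (Or c b)"
  using assms(1) unfolding deriv_on_def
proof (induction rule: rtranclp_induct)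
  case (step y z)
  have "move (V \<union> vars c) (Or c y) (Or c z)"
    using step(2) assms(2,3) unfolding move_def
    by (auto intro!: step.or_r acu.ctx_or_r; blast)
  with step show ?case by simp
qed simp

lemma deriv_on_And:
  assumes "deriv_on V a a'" "deriv_on W b b'" "V \<inter> W = {}"
    "linear a'" "vars a' \<subseteq> V" "linear b" "vars b \<subseteq> W"
  shows "deriv_on (V \<union> W) (And a b) (And a' b')"
proof -
  have "deriv_on (V \<union> W) (And a b) (And a' b)"
    using deriv_on_And_l[OF assms(1), of b] assms by (auto intro: deriv_on_mono)
  moreover have "deriv_on (V \<union> W) (And a' b) (And a' b')"
    using deriv_on_And_r[OF assms(2), of a'] assms by (auto intro: deriv_on_mono)
  ultimately show ?thesis by (rule deriv_on_trans)
qed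

lemma deriv_on_Or:
  assumes "deriv_on V a a'" "deriv_on W b b'" "V \<inter> W = {}"
    "linear a'" "vars a' \<subseteq> V" "linear b" "vars b \<subseteq> W"
  shows "deriv_on (V \<union> W) (Or a b) (Or a' b')"
proof -
  have "deriv_on (V \<union> W) (Or a b) (Or a' b)"
    using deriv_on_Or_l[OF assms(1), of b] assms by (auto intro: deriv_on_mono)
  moreover have "deriv_on (V \<union> W) (Or a' b) (Or a' b')"
    using deriv_on_Or_r[OF assms(2), of a'] assms by (auto intro: deriv_on_mono)
  ultimately show ?thesis by (rule deriv_on_trans)
qed

lemma step_switch:
  assumes "linear (And a (Or b c))"
  shows "step SM (And a (Or b c)) (Or (And a b) c)"
proof -
  let ?s = "\<lambda>n::nat. if n = 0 then a else if n = 1 then b else c"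
  have "step SM (subst ?s (fst switch)) (subst ?s (snd switch))"
    using assms by (intro step.inst) (auto simp: switch_def)
  then show ?thesis by (simp add: switch_def)
qed

lemma step_medial:
  assumes "linear (Or (And a b) (And c d))"
  shows "step SM (Or (And a b) (And c d)) (And (Or a c) (Or b d))"
proof -
  let ?s = "\<lambda>n::nat. if n = 0 then a else if n = 1 then b else if n = 2 then c else d"
  have "step SM (subst ?s (fst medial)) (subst ?s (snd medial))"
    using assms by (intro step.inst) (auto simp: medial_def)
  then show ?thesis by (simp add: medial_def)
qed

section \<open>Duality under negation\<close>

lemma vars_neg [simp]: "vars (neg a) = vars a"
  by (induction a) auto

lemma linear_neg [simp]: "linear (neg a) = linear a"
  by (induction a) auto

lemma neg_neg [simp]: "neg (neg a) = a"
  by (induction a) auto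

lemma eval_neg [simp]: "eval \<alpha> (neg a) = (\<not> eval \<alpha> a)"
  by (induction a) auto

lemma acu_neg: "acu a b \<Longrightarrow> acu (neg a) (neg b)"
proof (induction rule: acu.induct)
  case (trans a b c) then show ?case by (blast intro: acu.trans)
qed (auto intro: acu.intros)

lemma step_vars: "step SM a b \<Longrightarrow> vars a = vars b"
  by (induction rule: step.induct) (auto simp: switch_def medial_def)

text \<open>A switch, negated and reversed, is a switch up to commutativity; medial becomes exactly
  a medial. This lets statements about disjunctions be obtained from those about
  conjunctions.\<close>

lemma deriv_on_neg_step:
  assumes "step SM a b" shows "deriv_on (vars a) (neg b) (neg a)"
  using assms
proof (induction rule: step.induct)
  case (inst l r \<sigma>)
  from inst(1) consider "(l, r) = switch" | "(l, r) = medial" by auto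
  then show ?case
  proof cases
    case 1
    define A B C where "A = neg (\<sigma> 0)" and "B = neg (\<sigma> 1)" and "C = neg (\<sigma> 2)"
    have l: "subst \<sigma> l = And (\<sigma> 0) (Or (\<sigma> 1) (\<sigma> 2))"
      and r: "subst \<sigma> r = Or (And (\<sigma> 0) (\<sigma> 1)) (\<sigma> 2)"
      using 1 by (auto simp: switch_def)
    have lin: "linear (Or A (And B C))" "vars A = vars (\<sigma> 0)" "vars B = vars (\<sigma> 1)" "vars C = vars (\<sigma> 2)"
      using inst(2) unfolding l A_def B_def C_def by auto
    let ?V = "vars A \<union> vars B \<union> vars C"
    have "acu (And (Or A B) C) (And C (Or A B))" using lin by (intro acu.and_comm) auto
    then have "deriv_on ?V (And (Or A B) C) (And C (Or A B))" by (rule deriv_on_acu) auto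
    also have "acu (And C (Or A B)) (And C (Or B A))"
      using lin by (intro acu.ctx_and_r acu.or_comm) auto
    then have "deriv_on ?V (And C (Or A B)) (And C (Or B A))" by (rule deriv_on_acu) auto
    also have "deriv_on ?V (And C (Or B A)) (Or (And C B) A)"
      using lin by (intro deriv_on_step step_switch) auto
    also have "acu (Or (And C B) A) (Or A (And C B))" using lin by (intro acu.or_comm) auto
    then have "deriv_on ?V (Or (And C B) A) (Or A (And C B))" by (rule deriv_on_acu) auto
    also have "acu (Or A (And C B)) (Or A (And B C))"
      using lin by (intro acu.ctx_or_r acu.and_comm) auto
    then have "deriv_on ?V (Or A (And C B)) (Or A (And B C))" by (rule deriv_on_acu) auto
    finally show ?thesis unfolding l r using lin by (simp add: A_def B_def C_def Un_assoc)
  next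
    case 2
    have l: "subst \<sigma> l = Or (And (\<sigma> 0) (\<sigma> 1)) (And (\<sigma> 2) (\<sigma> 3))"
      and r: "subst \<sigma> r = And (Or (\<sigma> 0) (\<sigma> 2)) (Or (\<sigma> 1) (\<sigma> 3))"
      using 2 by (auto simp: medial_def)
    have "linear (Or (And (\<sigma> 0) (\<sigma> 2)) (And (\<sigma> 1) (\<sigma> 3)))" using inst(2) unfolding l by auto
    then show ?thesis unfolding l r by (intro deriv_on_step) (auto intro!: step_medial)
  qed
next
  case (and_l a b c)
  then show ?case using deriv_on_Or_l[OF and_l.IH, of "neg c"] by (auto simp: Int_commute)
next
  case (and_r a b c)
  then show ?case using deriv_on_Or_r[OF and_r.IH, of "neg c"] by (auto simp: Un_commute)
next
  case (or_l a b c)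
  then show ?case using deriv_on_And_l[OF or_l.IH, of "neg c"] by (auto simp: Int_commute)
next
  case (or_r a b c)
  then show ?case using deriv_on_And_r[OF or_r.IH, of "neg c"] by (auto simp: Un_commute)
qed

lemma deriv_on_neg:
  assumes "deriv_on V a b" shows "deriv_on V (neg b) (neg a)"
  using assms unfolding deriv_on_def
proof (induction rule: rtranclp_induct)
  case (step y z)
  have "deriv_on V (neg z) (neg y)"
    using step(2) unfolding move_def
    by (metis acu.sym acu_neg deriv_on_acu deriv_on_mono deriv_on_neg_step vars_neg)
  with step(3) show ?case unfolding deriv_on_def by (rule rtranclp_trans[rotated])
qed simp

lemma deriv_on_negI: "deriv_on V (neg b) (neg a) \<Longrightarrow> deriv_on V a b"
  using deriv_on_neg by fastforce

section \<open>Weakening\<close>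

lemma deriv_on_Bot:
  assumes "linear a" "vars a \<subseteq> V" shows "deriv_on V Bot a"
proof -
  \<comment> \<open>\<open>Bot\<close> absorbs \<open>Top \<or> a\<close>, so \<open>a\<close> can
    be created beside it; switch then moves \<open>a\<close> out of the conjunction.\<close>
  have "acu (And Bot (Or Top a)) Bot" using assms by (intro acu.and_bot_l) auto
  then have "deriv_on V Bot (And Bot (Or Top a))"
    by (rule deriv_on_acu[OF acu.sym]) (use assms in auto)
  also have "deriv_on V (And Bot (Or Top a)) (Or (And Bot Top) a)"
    using assms by (intro deriv_on_step step_switch) auto
  also have "acu (Or (And Bot Top) a) (Or Bot a)"
    using assms by (intro acu.ctx_or_l acu.and_top_r) auto
  then have "deriv_on V (Or (And Bot Top) a) (Or Bot a)" by (rule deriv_on_acu) (use assms in auto)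
  also have "deriv_on V (Or Bot a) a" by (rule deriv_on_acu) (use assms in \<open>auto intro: acu.or_bot_l\<close>)
  finally show ?thesis .
qed

lemma deriv_on_Top: "linear a \<Longrightarrow> vars a \<subseteq> V \<Longrightarrow> deriv_on V a Top"
  by (rule deriv_on_negI) (simp add: deriv_on_Bot)

text \<open>Literals on variables outside \<open>L\<close> give way to the unit \<open>t\<close>
  regardless of polarity. With \<open>t = Top\<close> the formula becomes weaker, with
  \<open>t = Bot\<close> stronger.\<close>

fun keep :: "nat set \<Rightarrow> lform \<Rightarrow> lform \<Rightarrow> lform" where
  "keep L t Top = Top" | "keep L t Bot = Bot"
| "keep L t (Var x) = (if x \<in> L then Var x else t)"
| "keep L t (NVar x) = (if x \<in> L then NVar x else t)"
| "keep L t (And a b) = And (keep L t a) (keep L t b)"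
| "keep L t (Or a b) = Or (keep L t a) (keep L t b)"

lemma vars_keep [simp]: "vars t = {} \<Longrightarrow> vars (keep L t a) = vars a \<inter> L"
  by (induction a) auto

lemma linear_keep: "linear t \<Longrightarrow> vars t = {} \<Longrightarrow> linear a \<Longrightarrow> linear (keep L t a)"
  by (induction a) auto

lemma neg_keep: "neg (keep L t a) = keep L (neg t) (neg a)"
  by (induction a) auto

lemma keep_id: "vars a \<subseteq> L \<Longrightarrow> keep L t a = a"
  by (induction a) auto

lemma deriv_on_keep_Top: "linear a \<Longrightarrow> deriv_on (vars a) a (keep L Top a)"
proof (induction a)
  case (And a b)
  then show ?case by (simp, intro deriv_on_And) (auto intro: linear_keep)
next
  case (Or a b)
  then show ?case by (simp, intro deriv_on_Or) (auto intro: linear_keep)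
qed (auto intro: deriv_on_Top)

lemma deriv_on_keep_Bot: "linear a \<Longrightarrow> deriv_on (vars a) (keep L Bot a) a"
  by (rule deriv_on_negI) (use deriv_on_keep_Top[of "neg a" L] in \<open>simp add: neg_keep\<close>)

lemma acu_and_swap: "linear (And (And a b) (And c d)) \<Longrightarrow> acu (And (And a b) (And c d)) (And (And a c) (And b d))"
proof -
  assume l: "linear (And (And a b) (And c d))"
  have "acu (And (And a b) (And c d)) (And (And (And a b) c) d)" using l by (intro acu.and_assoc) auto
  also have "acu \<dots> (And (And a (And b c)) d)"
    using l by (intro acu.ctx_and_l acu.sym[OF acu.and_assoc]) auto
  also have "acu \<dots> (And (And a (And c b)) d)"
    using l by (intro acu.ctx_and_l acu.ctx_and_r acu.and_comm) auto
  also have "acu \<dots> (And (And (And a c) b) d)"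
    using l by (intro acu.ctx_and_l acu.and_assoc) auto
  also have "acu \<dots> (And (And a c) (And b d))"
    using l by (intro acu.sym[OF acu.and_assoc]) auto
  finally show ?thesis .
qed

text \<open>One medial step per disjunction, working up from the leaves.\<close>

lemma deriv_on_split:
  assumes "linear a" "vars a \<subseteq> A \<union> B" "A \<inter> B = {}"
  shows "deriv_on (vars a) a (And (keep A Top a) (keep B Top a))"
  using assms(1,2)
proof (induction a)
  case (Var x)
  then show ?case using assms(3)
    by (auto intro!: deriv_on_acu intro: acu.sym[OF acu.and_top_r] acu.sym[OF acu.and_top_l])
next
  case (NVar x)
  then show ?case using assms(3)
    by (auto intro!: deriv_on_acu intro: acu.sym[OF acu.and_top_r] acu.sym[OF acu.and_top_l])
next
  case Top
  then show ?case by (auto intro!: deriv_on_acu intro: acu.sym[OF acu.and_top_r])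
next
  case Bot
  then show ?case by (auto intro!: deriv_on_acu intro: acu.sym[OF acu.and_bot_r])
next
  case (And a b)
  have l: "linear (keep L Top x)" if "x \<in> {a,b}" for L x using And.prems that by (auto intro: linear_keep)
  let ?a = "And (keep A Top a) (keep B Top a)" and ?b = "And (keep A Top b) (keep B Top b)"
  have "deriv_on (vars a \<union> vars b) (And a b) (And ?a ?b)"
    using And assms(3) l by (intro deriv_on_And) auto
  also have "acu (And ?a ?b) (And (And (keep A Top a) (keep A Top b)) (And (keep B Top a) (keep B Top b)))"
    using And.prems assms(3) l by (intro acu_and_swap) auto
  then have "deriv_on (vars a \<union> vars b) (And ?a ?b) (And (And (keep A Top a) (keep A Top b)) (And (keep B Top a) (keep B Top b)))"
    by (rule deriv_on_acu) auto
  finally show ?case by simp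
next
  case (Or a b)
  have l: "linear (keep L Top x)" if "x \<in> {a,b}" for L x using Or.prems that by (auto intro: linear_keep)
  let ?a = "And (keep A Top a) (keep B Top a)" and ?b = "And (keep A Top b) (keep B Top b)"
  have "deriv_on (vars a \<union> vars b) (Or a b) (Or ?a ?b)"
    using Or assms(3) l by (intro deriv_on_Or) auto
  also have "deriv_on (vars a \<union> vars b) (Or ?a ?b) (And (Or (keep A Top a) (keep A Top b)) (Or (keep B Top a) (keep B Top b)))"
    using Or.prems assms(3) l by (intro deriv_on_step step_medial) auto
  finally show ?case by simp
qed

section \<open>Literals, and inserting one at its place\<close>

fun lits :: "lform \<Rightarrow> (nat \<times> bool) set" where
  "lits Top = {}" | "lits Bot = {}" | "lits (Var x) = {(x, True)}" | "lits (NVar x) = {(x, False)}"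
| "lits (And a b) = lits a \<union> lits b" | "lits (Or a b) = lits a \<union> lits b"

definition lit :: "nat \<Rightarrow> bool \<Rightarrow> lform" where
  "lit x b = (if b then Var x else NVar x)"

lemma lit_simps [simp]: "vars (lit x b) = {x}" "linear (lit x b)" "lits (lit x b) = {(x, b)}"
  by (auto simp: lit_def)

lemma vars_lits: "vars a = fst ` lits a"
  by (induction a) auto

lemma lits_vars: "(x, b) \<in> lits a \<Longrightarrow> x \<in> vars a"
  by (force simp: vars_lits)

text \<open>The literal travels down to its own leaf, past conjunctions by associativity and
  commutativity and past disjunctions by switch. At the leaf it absorbs the \<open>Top\<close> that
  stands in for it.\<close>

lemma deriv_on_push:
  assumes "linear a" "(x, b) \<in> lits a"
  shows "deriv_on (vars a) (And (lit x b) (keep (-{x}) Top a)) a"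
  using assms
proof (induction a)
  case (Var y)
  then show ?case by (auto simp: lit_def intro!: deriv_on_acu intro: acu.and_top_r)
next
  case (NVar y)
  then show ?case by (auto simp: lit_def intro!: deriv_on_acu intro: acu.and_top_r)
next
  case (And c d)
  let ?l = "lit x b" and ?k = "keep (-{x}) Top"
  have l: "linear (?k c)" "linear (?k d)" using And.prems by (auto intro: linear_keep)
  show ?case
  proof (cases "(x, b) \<in> lits c")
    case True
    then have x: "x \<in> vars c" "x \<notin> vars d" using And.prems lits_vars by auto
    then have d: "?k d = d" by (intro keep_id) auto
    have "acu (And ?l (And (?k c) d)) (And (And ?l (?k c)) d)"
      using And.prems l x by (intro acu.and_assoc) auto
    then have "deriv_on (vars (And c d)) (And ?l (And (?k c) d)) (And (And ?l (?k c)) d)"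
      by (rule deriv_on_acu) (use x in auto)
    also have "deriv_on (vars (And c d)) (And (And ?l (?k c)) d) (And c d)"
      using And True deriv_on_And_l[of "vars c" _ c d] by (auto simp: Int_commute)
    finally show ?thesis by (simp add: d)
  next
    case False
    then have m: "(x, b) \<in> lits d" using And.prems by auto
    then have x: "x \<in> vars d" "x \<notin> vars c" using And.prems lits_vars by auto
    then have c: "?k c = c" by (intro keep_id) auto
    have "acu (And ?l (And c (?k d))) (And (And ?l c) (?k d))"
      using And.prems l x by (intro acu.and_assoc) auto
    also have "acu (And (And ?l c) (?k d)) (And (And c ?l) (?k d))"
      using And.prems l x by (intro acu.ctx_and_l acu.and_comm) auto
    also have "acu (And (And c ?l) (?k d)) (And c (And ?l (?k d)))"
      using And.prems l x by (intro acu.sym[OF acu.and_assoc]) auto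
    finally have "deriv_on (vars (And c d)) (And ?l (And c (?k d))) (And c (And ?l (?k d)))"
      by (rule deriv_on_acu) (use x in auto)
    also have "deriv_on (vars (And c d)) (And c (And ?l (?k d))) (And c d)"
      using And m deriv_on_And_r[of "vars d" _ d c] by (auto simp: Un_commute)
    finally show ?thesis by (simp add: c)
  qed
next
  case (Or c d)
  let ?l = "lit x b" and ?k = "keep (-{x}) Top"
  have l: "linear (?k c)" "linear (?k d)" using Or.prems by (auto intro: linear_keep)
  show ?case
  proof (cases "(x, b) \<in> lits c")
    case True
    then have x: "x \<in> vars c" "x \<notin> vars d" using Or.prems lits_vars by auto
    then have d: "?k d = d" by (intro keep_id) auto
    have "deriv_on (vars (Or c d)) (And ?l (Or (?k c) d)) (Or (And ?l (?k c)) d)"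
      using Or.prems l x by (intro deriv_on_step step_switch) auto
    also have "deriv_on (vars (Or c d)) (Or (And ?l (?k c)) d) (Or c d)"
      using Or True deriv_on_Or_l[of "vars c" _ c d] by (auto simp: Int_commute)
    finally show ?thesis by (simp add: d)
  next
    case False
    then have m: "(x, b) \<in> lits d" using Or.prems by auto
    then have x: "x \<in> vars d" "x \<notin> vars c" using Or.prems lits_vars by auto
    then have c: "?k c = c" by (intro keep_id) auto
    have "acu (And ?l (Or c (?k d))) (And ?l (Or (?k d) c))"
      using Or.prems l x by (intro acu.ctx_and_r acu.or_comm) auto
    then have "deriv_on (vars (Or c d)) (And ?l (Or c (?k d))) (And ?l (Or (?k d) c))"
      by (rule deriv_on_acu) (use x in auto)
    also have "deriv_on (vars (Or c d)) (And ?l (Or (?k d) c)) (Or (And ?l (?k d)) c)"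
      using Or.prems l x by (intro deriv_on_step step_switch) auto
    also have "deriv_on (vars (Or c d)) (Or (And ?l (?k d)) c) (Or d c)"
      using Or m deriv_on_Or_l[of "vars d" _ d c] by (auto simp: Un_commute)
    also have "deriv_on (vars (Or c d)) (Or d c) (Or c d)"
      using Or.prems by (intro deriv_on_acu acu.or_comm) auto
    finally show ?thesis by (simp add: c)
  qed
qed auto

section \<open>Reductions\<close>

lemma acu_eval: "acu a b \<Longrightarrow> eval \<alpha> a = eval \<alpha> b"
  by (induction rule: acu.induct) auto

lemma step_eval: "step SM a b \<Longrightarrow> eval \<alpha> a \<Longrightarrow> eval \<alpha> b"
  by (induction rule: step.induct) (auto simp: switch_def medial_def)

lemma finite_vars [simp]: "finite (vars a)"
  by (induction a) auto

lemma linear_lits: "linear a \<Longrightarrow> (x, True) \<in> lits a \<Longrightarrow> (x, False) \<notin> lits a"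
  by (induction a) (auto dest: lits_vars)

lemma lits_neg: "(x, b) \<in> lits (neg a) \<longleftrightarrow> (x, \<not> b) \<in> lits a"
  by (induction a) auto

lemma linear_inference_neg:
  "linear_inference a b \<Longrightarrow> linear_inference (neg b) (neg a)"
  by (auto simp: linear_inference_def)

section \<open>Deleting literals from an inference\<close>

lemma eval_keep_Top:
  assumes "\<And>x. x \<in> L \<Longrightarrow> \<alpha>' x = \<alpha> x" "\<And>x b. (x, b) \<in> lits a \<Longrightarrow> x \<notin> L \<Longrightarrow> \<alpha>' x = b"
  shows "eval \<alpha> (keep L Top a) = eval \<alpha>' a"
  using assms(2) by (induction a) (auto simp: assms(1))

lemma eval_keep_Bot:
  assumes "\<And>x. x \<in> L \<Longrightarrow> \<alpha>' x = \<alpha> x" "\<And>x b. (x, b) \<in> lits a \<Longrightarrow> x \<notin> L \<Longrightarrow> \<alpha>' x = (\<not> b)"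
  shows "eval \<alpha> (keep L Bot a) = eval \<alpha>' a"
  using assms(2) by (induction a) (auto simp: assms(1))

text \<open>Outside \<open>L\<close> no literal occurs on both sides, so each such variable has a
  value that makes its literal in \<open>a\<close> true and its literal in \<open>b\<close> false.
  With these values the given inference is the one between the restrictions.\<close>

lemma linear_inference_keep:
  assumes "linear_inference a b"
    and opp: "\<And>x c. x \<notin> L \<Longrightarrow> (x, c) \<in> lits a \<Longrightarrow> (x, c) \<notin> lits b"
  shows "linear_inference (keep L Top a) (keep L Bot b)"
proof -
  have lin: "linear a" "linear b" using assms(1) by (auto simp: linear_inference_def)
  have "eval \<alpha> (keep L Bot b)" if "eval \<alpha> (keep L Top a)" for \<alpha>
  proof -
    \<comment> \<open>Outside \<open>L\<close>, a variable of \<open>a\<close> is set so that its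
      literal is true; a variable that only \<open>b\<close> has is set so that its literal is
      false.\<close>
    define \<alpha>' where "\<alpha>' = (\<lambda>x. if x \<in> L then \<alpha> x
      else (x, True) \<in> lits a \<or> (x, False) \<notin> lits a \<and> (x, False) \<in> lits b)"
    have "eval \<alpha> (keep L Top a) = eval \<alpha>' a"
    proof (rule eval_keep_Top)
      fix x c assume "(x, c) \<in> lits a" "x \<notin> L"
      then show "\<alpha>' x = c" using linear_lits[OF lin(1), of x] by (cases c) (auto simp: \<alpha>'_def)
    qed (simp add: \<alpha>'_def)
    moreover have "eval \<alpha> (keep L Bot b) = eval \<alpha>' b"
    proof (rule eval_keep_Bot)
      fix x c assume "(x, c) \<in> lits b" "x \<notin> L"
      then show "\<alpha>' x = (\<not> c)"
        using linear_lits[OF lin(2), of x] opp[of x c] by (cases c) (auto simp: \<alpha>'_def)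
    qed (simp add: \<alpha>'_def)
    ultimately show ?thesis using that assms(1) by (auto simp: linear_inference_def)
  qed
  then show ?thesis using lin by (auto simp: linear_inference_def intro: linear_keep)
qed

section \<open>Unit-free formulae as monotone functions\<close>

fun ufree :: "lform \<Rightarrow> bool" where
  "ufree Top = False" | "ufree Bot = False" | "ufree (Var x) = True" | "ufree (NVar x) = True"
| "ufree (And a b) = (ufree a \<and> ufree b)" | "ufree (Or a b) = (ufree a \<and> ufree b)"

text \<open>Here \<open>P\<close> is a set of true literals, named by their variables: negative literals count as positive.\<close>

fun sat :: "nat set \<Rightarrow> lform \<Rightarrow> bool" where
  "sat P Top = True" | "sat P Bot = False" | "sat P (Var x) = (x \<in> P)" | "sat P (NVar x) = (x \<in> P)"
| "sat P (And a b) = (sat P a \<and> sat P b)" | "sat P (Or a b) = (sat P a \<or> sat P b)"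

fun conjs :: "lform \<Rightarrow> lform set" where
  "conjs (And a b) = conjs a \<union> conjs b" | "conjs a = {a}"

fun disjs :: "lform \<Rightarrow> lform set" where
  "disjs (Or a b) = disjs a \<union> disjs b" | "disjs a = {a}"

lemma ufree_neg [simp]: "ufree (neg a) = ufree a"
  by (induction a) auto

text \<open>Since \<open>sat\<close> ignores polarity, negation only exchanges the connectives; De
  Morgan then calls for the complement of \<open>P\<close>.\<close>

lemma sat_neg: "sat P (neg a) = (\<not> sat (-P) a)"
  by (induction a) auto

lemma conjs_neg: "conjs (neg a) = neg ` disjs a"
  by (induction a) auto

lemma disjs_neg: "disjs (neg a) = neg ` conjs a"
  by (induction a) auto

lemma sat_mono: "sat P a \<Longrightarrow> P \<subseteq> Q \<Longrightarrow> sat Q a"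
  by (induction a) auto

lemma sat_cong: "P \<inter> vars a = Q \<inter> vars a \<Longrightarrow> sat P a = sat Q a"
proof (induction a)
  case (And a b)
  then have "P \<inter> vars a = Q \<inter> vars a" "P \<inter> vars b = Q \<inter> vars b" by auto
  with And show ?case by simp
next
  case (Or a b)
  then have "P \<inter> vars a = Q \<inter> vars a" "P \<inter> vars b = Q \<inter> vars b" by auto
  with Or show ?case by simp
qed auto

lemma sat_conjs: "sat P a \<longleftrightarrow> (\<forall>c\<in>conjs a. sat P c)"
  by (induction a) auto

lemma sat_disjs: "sat P a \<longleftrightarrow> (\<exists>d\<in>disjs a. sat P d)"
  by (induction a) auto

lemma eval_sat:
  assumes "lits a \<subseteq> \<Lambda>" "\<And>x. (x, True) \<in> \<Lambda> \<Longrightarrow> (x, False) \<notin> \<Lambda>"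
  shows "eval \<alpha> a = sat {x. (x, \<alpha> x) \<in> \<Lambda>} a"
  using assms(1)
proof (induction a)
  case (Var x)
  with assms(2)[of x] show ?case by (cases "\<alpha> x") auto
next
  case (NVar x)
  with assms(2)[of x] show ?case by (cases "\<alpha> x") auto
qed auto

text \<open>When both sides draw their literals from one set with a single polarity per variable,
  the assignments realise every choice of true literals. So validity can be tested on the monotone
  functions.\<close>

lemma inference_sat:
  assumes "lits a \<subseteq> \<Lambda>" "lits b \<subseteq> \<Lambda>" "\<And>x. (x, True) \<in> \<Lambda> \<Longrightarrow> (x, False) \<notin> \<Lambda>"
  shows "(\<forall>\<alpha>. eval \<alpha> a \<longrightarrow> eval \<alpha> b) \<longleftrightarrow> (\<forall>P. sat P a \<longrightarrow> sat P b)"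
proof
  assume e: "\<forall>\<alpha>. eval \<alpha> a \<longrightarrow> eval \<alpha> b"
  show "\<forall>P. sat P a \<longrightarrow> sat P b"
  proof (intro allI impI)
    fix P assume s: "sat P a"
    \<comment> \<open>Chosen so that the true literals of \<open>\<Lambda>\<close> are exactly those
      named by \<open>P\<close>.\<close>
    define \<alpha> where "\<alpha> x = (if (x, True) \<in> \<Lambda> then x \<in> P else x \<notin> P)" for x
    have "{x. (x, \<alpha> x) \<in> \<Lambda>} = P \<inter> fst ` \<Lambda>"
    proof (intro set_eqI iffI)
      fix x assume "x \<in> {x. (x, \<alpha> x) \<in> \<Lambda>}"
      then show "x \<in> P \<inter> fst ` \<Lambda>" using assms(3)[of x]
        by (cases "(x, True) \<in> \<Lambda>"; cases "x \<in> P") (force simp: \<alpha>_def)+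
    next
      fix x assume "x \<in> P \<inter> fst ` \<Lambda>"
      then obtain b where "x \<in> P" "(x, b) \<in> \<Lambda>" by auto
      then show "x \<in> {x. (x, \<alpha> x) \<in> \<Lambda>}" by (cases b) (auto simp: \<alpha>_def)
    qed
    moreover have "sat (P \<inter> fst ` \<Lambda>) c = sat P c" if "lits c \<subseteq> \<Lambda>" for c
      using that by (intro sat_cong) (auto simp: vars_lits)
    ultimately show "sat P b"
      using s e eval_sat[OF assms(1,3), of \<alpha>] eval_sat[OF assms(2,3), of \<alpha>] assms(1,2) by auto
  qed
qed (use eval_sat assms in blast)

lemma ufree_vars: "ufree a \<Longrightarrow> vars a \<noteq> {}"
  by (induction a) auto

lemma ufree_card_vars: "ufree a \<Longrightarrow> 1 \<le> card (vars a)"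
  using ufree_vars[of a] by (simp add: Suc_le_eq card_gt_0_iff)

lemma ufree_sat: "ufree a \<Longrightarrow> vars a \<subseteq> P \<Longrightarrow> sat P a"
  by (induction a) auto

lemma ufree_not_sat: "ufree a \<Longrightarrow> P \<inter> vars a = {} \<Longrightarrow> \<not> sat P a"
  by (induction a) auto

lemma card_vars_And: "linear (And a b) \<Longrightarrow> card (vars (And a b)) = card (vars a) + card (vars b)"
  by (simp add: card_Un_disjoint)

lemma card_vars_Or: "linear (Or a b) \<Longrightarrow> card (vars (Or a b)) = card (vars a) + card (vars b)"
  by (simp add: card_Un_disjoint)

section \<open>Conjuncts and disjuncts\<close>

lemma Union_vars_conjs: "(\<Union>c\<in>conjs a. vars c) = vars a"
  by (induction a) auto

lemma conjs_props: "c \<in> conjs a \<Longrightarrow> conjs c = {c} \<and> lits c \<subseteq> lits a \<and> vars c \<subseteq> vars a \<and> (linear a \<longrightarrow> linear c) \<and> (ufree a \<longrightarrow> ufree c)"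
  by (induction a) auto

lemma conjs_disjoint:
  "linear a \<Longrightarrow> ufree a \<Longrightarrow> c \<in> conjs a \<Longrightarrow> d \<in> conjs a \<Longrightarrow> c \<noteq> d \<Longrightarrow> vars c \<inter> vars d = {}"
proof (induction a)
  case (And a b)
  have "vars x \<inter> vars y = {}" if "x \<in> conjs a" "y \<in> conjs b" for x y
    using And.prems(1) conjs_props[OF that(1)] conjs_props[OF that(2)] by auto
  with And show ?case by auto
qed auto

lemma Union_vars_disjs: "(\<Union>c\<in>disjs a. vars c) = vars a"
  by (induction a) auto

lemma disjs_props: "c \<in> disjs a \<Longrightarrow> disjs c = {c} \<and> lits c \<subseteq> lits a \<and> vars c \<subseteq> vars a \<and> (linear a \<longrightarrow> linear c) \<and> (ufree a \<longrightarrow> ufree c)"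
  by (induction a) auto

lemma disjs_disjoint:
  "linear a \<Longrightarrow> ufree a \<Longrightarrow> c \<in> disjs a \<Longrightarrow> d \<in> disjs a \<Longrightarrow> c \<noteq> d \<Longrightarrow> vars c \<inter> vars d = {}"
proof (induction a)
  case (Or a b)
  have "vars x \<inter> vars y = {}" if "x \<in> disjs a" "y \<in> disjs b" for x y
    using Or.prems(1) disjs_props[OF that(1)] disjs_props[OF that(2)] by auto
  with Or show ?case by auto
qed auto

lemma conjs_extract:
  assumes "linear a" "ufree a" "c \<in> conjs a" "a \<noteq> c"
  obtains r where "acu a (And c r)" "ufree r" "vars r = vars a - vars c" "conjs r = conjs a - {c}"
proof -
  have "a = c \<or> (\<exists>r. acu a (And c r) \<and> ufree r \<and> vars r = vars a - vars c \<and> conjs r = conjs a - {c})"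
    using assms(1-3)
  proof (induction a)
    case (And a b)
    have aux: "\<exists>r. acu (And a b) (And c r) \<and> ufree r \<and> vars r = vars a \<union> vars b - vars c \<and> conjs r = (conjs a \<union> conjs b) - {c}"
      if ab: "linear (And a b)" "ufree a" "ufree b" "c \<in> conjs a"
        and IH: "a = c \<or> (\<exists>r. acu a (And c r) \<and> ufree r \<and> vars r = vars a - vars c \<and> conjs r = conjs a - {c})"
      for a b
    proof -
      have c: "vars c \<subseteq> vars a" "ufree c" "conjs c = {c}" using conjs_props[OF ab(4)] ab by auto
      \<comment> \<open>\<open>conjs\<close> is a set, so a second copy of \<open>c\<close> would
        vanish together with the first. Linearity rules it out, as unit-freeness gives
        \<open>c\<close> a variable.\<close>
      have "c \<notin> conjs b" using conjs_props[of c b] ab(1) c(1) ufree_vars[OF c(2)] by fastforce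
      from IH show ?thesis
      proof
        assume "a = c"
        then show ?thesis using ab c \<open>c \<notin> conjs b\<close>
          by (intro exI[of _ b]) (auto intro: acu.refl)
      next
        assume "\<exists>r. acu a (And c r) \<and> ufree r \<and> vars r = vars a - vars c \<and> conjs r = conjs a - {c}"
        then obtain r where r: "acu a (And c r)" "ufree r" "vars r = vars a - vars c" "conjs r = conjs a - {c}"
          by auto
        have l: "linear (And c r)" using acu_linear[OF r(1)] by simp
        then have l': "linear (And (And c r) b)" using ab(1) r(3) c(1) by auto
        have "acu (And a b) (And (And c r) b)" using r(1) ab(1) l' by (intro acu.ctx_and_l) auto
        also have "acu \<dots> (And c (And r b))" using l' by (intro acu.sym[OF acu.and_assoc]) auto
        finally show ?thesis using r ab c \<open>c \<notin> conjs b\<close> by (intro exI[of _ "And r b"]) auto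
      qed
    qed
    show ?case
    proof (cases "c \<in> conjs a")
      case True
      then show ?thesis using aux[of a b] And by auto
    next
      case False
      then have "c \<in> conjs b" using And by auto
      then obtain r where r: "acu (And b a) (And c r)" "ufree r" "vars r = vars b \<union> vars a - vars c" "conjs r = (conjs b \<union> conjs a) - {c}"
        using aux[of b a] And by (auto simp: Int_commute)
      have "acu (And a b) (And b a)" using And.prems by (intro acu.and_comm) auto
      from acu.trans[OF this r(1)] show ?thesis using r by auto
    qed
  qed auto
  with assms(4) that show ?thesis by blast
qed

lemma disjs_extract:
  assumes "linear a" "ufree a" "c \<in> disjs a" "a \<noteq> c"
  obtains r where "acu a (Or c r)" "ufree r" "vars r = vars a - vars c" "disjs r = disjs a - {c}"
proof -
  have "neg a \<noteq> neg c" using assms(4) neg_neg by metis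
  then obtain r where r: "acu (neg a) (And (neg c) r)" "ufree r" "vars r = vars a - vars c"
    "conjs r = conjs (neg a) - {neg c}"
    using conjs_extract[of "neg a" "neg c"] assms by (auto simp: conjs_neg)
  have inj: "inj neg" by (rule inj_on_inverseI[where g = neg]) simp
  then have "disjs (neg r) = disjs a - {c}"
    unfolding disjs_neg r(4) conjs_neg by (simp add: image_set_diff[OF inj] image_image)
  with r acu_neg[OF r(1)] that[of "neg r"] show ?thesis by simp
qed

lemma ufree_literal:
  assumes "ufree a" "linear a" "card (vars a) < 2"
  obtains x b where "a = lit x b"
proof (cases a)
  case (And c d)
  then show ?thesis using assms card_vars_And[of c d] ufree_card_vars[of c] ufree_card_vars[of d] by auto
next
  case (Or c d)
  then show ?thesis using assms card_vars_Or[of c d] ufree_card_vars[of c] ufree_card_vars[of d] by auto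
next
  case (Var x)
  then show ?thesis using that[of x True] by (simp add: lit_def)
next
  case (NVar x)
  then show ?thesis using that[of x False] by (simp add: lit_def)
qed (use assms in auto)

text \<open>Bottom up: at each connective an absorbing unit takes over and a neutral unit
  disappears, so a unit survives only as the whole formula.\<close>

lemma unit_normal_form:
  assumes "linear a"
  obtains b where "acu a b" "lits b \<subseteq> lits a" "b = Top \<or> b = Bot \<or> ufree b"
proof -
  have "\<exists>b. acu a b \<and> lits b \<subseteq> lits a \<and> (b = Top \<or> b = Bot \<or> ufree b)"
    using assms
  proof (induction a)
    case (And a1 a2)
    then obtain b1 b2 where b: "acu a1 b1" "lits b1 \<subseteq> lits a1" "b1 = Top \<or> b1 = Bot \<or> ufree b1"
      "acu a2 b2" "lits b2 \<subseteq> lits a2" "b2 = Top \<or> b2 = Bot \<or> ufree b2" by auto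
    have v: "vars b1 \<subseteq> vars a1" "vars b2 \<subseteq> vars a2" using b by (auto simp: vars_lits)
    have l: "linear b1" "linear b2" using acu_linear b by auto
    have "acu (And a1 a2) (And b1 a2)" using And.prems b v l by (intro acu.ctx_and_l) auto
    also have "acu \<dots> (And b1 b2)" using And.prems b v l by (intro acu.ctx_and_r) auto
    finally have 1: "acu (And a1 a2) (And b1 b2)" .
    have t: "acu (And a1 a2) c" if "acu (And b1 b2) c" for c using 1 that by (rule acu.trans)
    show ?case
    proof (cases "b1 = Bot \<or> b2 = Bot")
      case True
      then show ?thesis using l by (auto intro!: exI[of _ Bot] t intro: acu.and_bot_l acu.and_bot_r)
    next
      case F: False
      show ?thesis
      proof (cases "b1 = Top \<or> b2 = Top")
        case True
        then show ?thesis
        proof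
          assume "b1 = Top"
          then have "acu (And a1 a2) b2" using l by (auto intro!: t intro: acu.and_top_l)
          then show ?thesis using b by auto
        next
          assume "b2 = Top"
          then have "acu (And a1 a2) b1" using l by (auto intro!: t intro: acu.and_top_r)
          then show ?thesis using b by auto
        qed
      next
        case False
        then show ?thesis using F b 1 by (intro exI[of _ "And b1 b2"]) auto
      qed
    qed
  next
    case (Or a1 a2)
    then obtain b1 b2 where b: "acu a1 b1" "lits b1 \<subseteq> lits a1" "b1 = Top \<or> b1 = Bot \<or> ufree b1"
      "acu a2 b2" "lits b2 \<subseteq> lits a2" "b2 = Top \<or> b2 = Bot \<or> ufree b2" by auto
    have v: "vars b1 \<subseteq> vars a1" "vars b2 \<subseteq> vars a2" using b by (auto simp: vars_lits)
    have l: "linear b1" "linear b2" using acu_linear b by auto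
    have "acu (Or a1 a2) (Or b1 a2)" using Or.prems b v l by (intro acu.ctx_or_l) auto
    also have "acu \<dots> (Or b1 b2)" using Or.prems b v l by (intro acu.ctx_or_r) auto
    finally have 1: "acu (Or a1 a2) (Or b1 b2)" .
    have t: "acu (Or a1 a2) c" if "acu (Or b1 b2) c" for c using 1 that by (rule acu.trans)
    show ?case
    proof (cases "b1 = Top \<or> b2 = Top")
      case True
      then show ?thesis using l by (auto intro!: exI[of _ Top] t intro: acu.or_top_l acu.or_top_r)
    next
      case F: False
      show ?thesis
      proof (cases "b1 = Bot \<or> b2 = Bot")
        case True
        then show ?thesis
        proof
          assume "b1 = Bot"
          then have "acu (Or a1 a2) b2" using l by (auto intro!: t intro: acu.or_bot_l)
          then show ?thesis using b by auto
        next
          assume "b2 = Bot"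
          then have "acu (Or a1 a2) b1" using l by (auto intro!: t intro: acu.or_bot_r)
          then show ?thesis using b by auto
        qed
      next
        case False
        then show ?thesis using F b 1 by (intro exI[of _ "Or b1 b2"]) auto
      qed
    qed
  next
    case Top show ?case by (intro exI[of _ Top]) (simp add: acu.refl)
  next
    case Bot show ?case by (intro exI[of _ Bot]) (simp add: acu.refl)
  next
    case (Var x) show ?case by (intro exI[of _ "Var x"]) (simp add: acu.refl)
  next
    case (NVar x) show ?case by (intro exI[of _ "NVar x"]) (simp add: acu.refl)
  qed
  with that show ?thesis by blast
qed

section \<open>Inferences that admit no switch at the root\<close>

text \<open>The pairs \<open>{u1,v1}\<close>, \<open>{u2,v2}\<close>, \<open>{u,v}\<close>, \<open>{u,w}\<close> are four edges of a graph in which only \<open>u\<close> can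
  have degree two; they are too few to meet all eight sets \<open>{s,t,a}\<close>, \<open>{s,t,b,c}\<close>. The cases \<open>b = c\<close>
  and \<open>v = w\<close> are allowed.\<close>

lemma pairs_miss_minterm:
  fixes x1 :: nat
  assumes "x1 \<noteq> y1" "x2 \<noteq> y2" "x1 \<noteq> x2" "x1 \<noteq> y2" "y1 \<noteq> x2" "y1 \<noteq> y2"
    "a \<notin> {x1,y1,x2,y2}" "b \<notin> {x1,y1,x2,y2}" "c \<notin> {x1,y1,x2,y2}" "a \<noteq> b" "a \<noteq> c"
   "u1 \<noteq> v1" "u2 \<noteq> v2" "u1 \<noteq> u2" "u1 \<noteq> v2" "v1 \<noteq> u2" "v1 \<noteq> v2"
    "u \<notin> {u1,v1,u2,v2}" "v \<notin> {u1,v1,u2,v2}" "w \<notin> {u1,v1,u2,v2}" "u \<noteq> v" "u \<noteq> w"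
  and G: "\<And>P. G P \<Longrightarrow> {u1,v1} \<subseteq> P \<or> {u2,v2} \<subseteq> P \<or> {u,v} \<subseteq> P \<or> {u,w} \<subseteq> P"
  and F: "\<And>s t. s \<in> {x1,y1} \<Longrightarrow> t \<in> {x2,y2} \<Longrightarrow> G {s,t,a} \<and> G {s,t,b,c}"
  and n: "{b,c} \<noteq> {u1,v1}" "{b,c} \<noteq> {u2,v2}" "{b,c} \<noteq> {u,v}" "{b,c} \<noteq> {u,w}"
   "{v,w} \<noteq> {x1,y1}" "{v,w} \<noteq> {x2,y2}"
  shows False
proof -
  have "G {x1,x2,a}" "G {x1,y2,a}" "G {y1,x2,a}" "G {y1,y2,a}" 
   "G {x1,x2,b,c}" "G {x1,y2,b,c}" "G {y1,x2,b,c}" "G {y1,y2,b,c}"  using F by auto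
  note this[THEN G]
  then show ?thesis using assms(1-22) n by (simp add: doubleton_eq_iff) (smt (verit))
qed

section \<open>Formulae with few variables\<close>

lemma conjs_not_And: "c \<in> conjs a \<Longrightarrow> c \<noteq> And x y"
  by (induction a) auto

lemma disjs_not_Or: "d \<in> disjs a \<Longrightarrow> d \<noteq> Or x y"
  by (induction a) auto

text \<open>Such a formula is neither an \<open>And\<close> nor an \<open>Or\<close>, which leaves a
  unit or a literal. So a conjunct with two or more variables is never its own disjunct.\<close>

lemma conj_disj_card:
  assumes "c \<in> conjs a" "c \<in> disjs b" shows "card (vars c) < 2"
  using conjs_not_And[OF assms(1)] disjs_not_Or[OF assms(2)] by (cases c) auto

lemma sat_insert: "x \<notin> vars a \<Longrightarrow> sat (insert x P) a = sat P a"
  by (rule sat_cong) auto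

lemma conjs_nonempty: "conjs a \<noteq> {}"
  by (induction a) auto

lemma lit_sat [simp]: "sat P (lit x b) = (x \<in> P)"
  by (auto simp: lit_def)

lemma other_conj:
  assumes "linear d" "ufree d" "2 \<le> card (vars d)" "disjs d = {d}" "e \<in> conjs d"
  obtains e' where "e' \<in> conjs d" "e' \<noteq> e"
proof -
  obtain x y where d: "d = And x y"
    using assms(2-4) disjs_not_Or[of d d] by (cases d) auto
  obtain p q where pq: "p \<in> conjs x" "q \<in> conjs y" using conjs_nonempty[of x] conjs_nonempty[of y] by auto
  have "vars p \<inter> vars q = {}" "vars p \<noteq> {}"
    using conjs_props[OF pq(1)] conjs_props[OF pq(2)] assms(1,2) d ufree_vars by auto
  then have "p \<noteq> q" by auto
  then show ?thesis using that pq d by (cases "p = e") auto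
qed

lemma other_disj:
  assumes "linear d" "ufree d" "2 \<le> card (vars d)" "conjs d = {d}" "e \<in> disjs d"
  obtains e' where "e' \<in> disjs d" "e' \<noteq> e"
proof -
  have "\<exists>e'. e' \<in> conjs (neg d) \<and> e' \<noteq> neg e"
    using other_conj[of "neg d" "neg e"] assms by (auto simp: conjs_neg disjs_neg)
  then show ?thesis using that unfolding conjs_neg by (metis imageE)
qed

lemma two_variable_formula:
  assumes "linear h" "ufree h" "card (vars h) = 2"
  obtains x y where "x \<noteq> y" "vars h = {x, y}"
    "disjs h = {h} \<and> (\<forall>P. sat P h = (x \<in> P \<and> y \<in> P)) \<or> conjs h = {h} \<and> (\<forall>P. sat P h = (x \<in> P \<or> y \<in> P))"
proof (cases h)
  case (And p q)
  have "card (vars p) < 2" "card (vars q) < 2"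
    using assms And card_vars_And[of p q] ufree_card_vars[of p] ufree_card_vars[of q] by auto
  then obtain x b y c where "p = lit x b" "q = lit y c"
    using ufree_literal[of p] ufree_literal[of q] assms And by (metis linear.simps(1) ufree.simps(5))
  then show ?thesis using that[of x y] And assms(1) by auto
next
  case (Or p q)
  have "card (vars p) < 2" "card (vars q) < 2"
    using assms Or card_vars_Or[of p q] ufree_card_vars[of p] ufree_card_vars[of q] by auto
  then obtain x b y c where "p = lit x b" "q = lit y c"
    using ufree_literal[of p] ufree_literal[of q] assms Or by (metis linear.simps(2) ufree.simps(6))
  then show ?thesis using that[of x y] Or assms(1) by auto
qed (use assms in auto)

text \<open>For a unit-free formula this says that \<open>vars a\<close> is its only minterm: it is
  a conjunction of literals.\<close>

definition pure :: "lform \<Rightarrow> bool" where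
  "pure a \<longleftrightarrow> (\<forall>P. sat P a \<longrightarrow> vars a \<subseteq> P)"

lemma pure_small:
  assumes "linear d" "ufree d" "disjs d = {d}" "card (vars d) \<le> 2"
  shows "pure d"
proof (cases "card (vars d) = 2")
  case True
  then obtain x y where xy: "x \<noteq> y" "vars d = {x, y}"
    "disjs d = {d} \<and> (\<forall>P. sat P d = (x \<in> P \<and> y \<in> P)) \<or> conjs d = {d} \<and> (\<forall>P. sat P d = (x \<in> P \<or> y \<in> P))"
    using two_variable_formula assms by metis
  from xy(3) show ?thesis
  proof
    assume "conjs d = {d} \<and> (\<forall>P. sat P d = (x \<in> P \<or> y \<in> P))"
    then have "card (vars d) < 2" using conj_disj_card[of d d d] assms(3) by auto
    with True show ?thesis by simp
  qed (use xy in \<open>auto simp: pure_def\<close>)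
next
  case False
  then obtain x b where "d = lit x b" using ufree_literal[of d] assms by force
  then show ?thesis by (auto simp: pure_def)
qed

text \<open>\<open>d\<close> is a conjunction of a one-variable and a two-variable part; were the
  latter a conjunction too, \<open>d\<close> would be pure.\<close>

lemma impure_three:
  assumes "linear d" "ufree d" "disjs d = {d}" "card (vars d) = 3" "\<not> pure d"
  obtains r s t where "vars d = {r, s, t}" "\<And>P. sat P d = (r \<in> P \<and> (s \<in> P \<or> t \<in> P))"
proof -
  note result = that
  have *: thesis if d: "linear (And p q)" "ufree (And p q)" "card (vars p) = 1" "card (vars q) = 2"
    "vars d = vars p \<union> vars q" "\<And>P. sat P d = (sat P p \<and> sat P q)" for p q
  proof -
    obtain r b where p: "p = lit r b" using ufree_literal[of p] d by auto
    obtain s t where st: "vars q = {s, t}"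
      "(\<forall>P. sat P q = (s \<in> P \<and> t \<in> P)) \<or> (\<forall>P. sat P q = (s \<in> P \<or> t \<in> P))"
      using two_variable_formula[of q] d by (metis linear.simps(1) ufree.simps(5))
    then show thesis using result[of r s t] assms(5) d(5,6) p by (auto simp: pure_def)
  qed
  obtain p q where d: "d = And p q" using assms disjs_not_Or[of d d] by (cases d) auto
  have "card (vars p) + card (vars q) = 3" "1 \<le> card (vars p)" "1 \<le> card (vars q)"
    using card_vars_And[of p q] assms d ufree_card_vars by auto
  then have "card (vars p) = 1 \<and> card (vars q) = 2 \<or> card (vars p) = 2 \<and> card (vars q) = 1" by arith
  then show ?thesis
  proof
    assume "card (vars p) = 1 \<and> card (vars q) = 2"
    then show ?thesis using assms d by (intro *[of p q]) auto
  next
    assume "card (vars p) = 2 \<and> card (vars q) = 1"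
    then show ?thesis using assms d by (intro *[of q p]) auto
  qed
qed

text \<open>A conjunction \<open>f\<close> implying a disjunction \<open>g\<close> such that no single switch at the root of \<open>f\<close>
  (resp. into the root of \<open>g\<close>) stays between them.\<close>

locale stuck_inference =
  fixes f g :: lform
  assumes lin: "linear f" "ufree f" "linear g" "ufree g" and vars_eq: "vars f = vars g"
    and card7: "card (vars f) \<le> 7"
    and conj2: "\<And>c. c \<in> conjs f \<Longrightarrow> 2 \<le> card (vars c)"
    and disj2: "\<And>d. d \<in> disjs g \<Longrightarrow> 2 \<le> card (vars d)"
    and fg: "\<And>P. sat P f \<Longrightarrow> sat P g"
    and stuck1: "\<And>c d. c \<in> conjs f \<Longrightarrow> d \<in> disjs c \<Longrightarrow> \<exists>P. sat P d \<and> \<not> sat P g"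
    and stuck2: "\<And>d e. d \<in> disjs g \<Longrightarrow> e \<in> conjs d \<Longrightarrow> \<exists>P. sat P f \<and> \<not> sat P e"
begin

text \<open>Negation swaps the two stuck conditions, so what is proved about the conjuncts of
  \<open>f\<close> also holds for the disjuncts of \<open>g\<close>.\<close>

lemma dual: "stuck_inference (neg g) (neg f)"
proof
  show "sat P (neg f)" if "sat P (neg g)" for P using that fg by (auto simp: sat_neg)
  show "\<exists>P. sat P d \<and> \<not> sat P (neg f)" if cd: "c \<in> conjs (neg g)" "d \<in> disjs c" for c d
  proof -
    obtain c' d' where "c' \<in> disjs g" "c = neg c'" "d' \<in> conjs c'" "d = neg d'"
      using cd by (auto simp: conjs_neg disjs_neg)
    with stuck2[of c' d'] show ?thesis by (metis double_complement sat_neg)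
  qed
  show "\<exists>P. sat P (neg g) \<and> \<not> sat P e" if de: "d \<in> disjs (neg f)" "e \<in> conjs d" for d e
  proof -
    obtain c' d' where "c' \<in> conjs f" "d = neg c'" "d' \<in> disjs c'" "e = neg d'"
      using de by (auto simp: conjs_neg disjs_neg)
    with stuck1[of c' d'] show ?thesis by (metis double_complement sat_neg)
  qed
qed (use lin vars_eq card7 conj2 disj2 in \<open>auto simp: conjs_neg disjs_neg\<close>)

lemma conj_f: "c \<in> conjs f \<Longrightarrow> linear c \<and> ufree c \<and> conjs c = {c} \<and> vars c \<subseteq> vars f"
  using conjs_props[of c f] lin by auto

lemma disj_g: "d \<in> disjs g \<Longrightarrow> linear d \<and> ufree d \<and> disjs d = {d} \<and> vars d \<subseteq> vars g"
  using disjs_props[of d g] lin by auto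

lemma conj_disj_g:
  assumes "d \<in> disjs g" "e \<in> conjs d" shows "linear e \<and> ufree e \<and> vars e \<subseteq> vars d"
  using conjs_props[OF assms(2)] disj_g[OF assms(1)] by auto

lemma disjoint_g:
  "d \<in> disjs g \<Longrightarrow> e \<in> conjs d \<Longrightarrow> e' \<in> conjs d \<Longrightarrow> e' \<noteq> e \<Longrightarrow> vars e \<inter> vars e' = {}"
  using conjs_disjoint[of d e e'] disj_g[of d] by auto

lemma locate:
  assumes "x \<in> vars g" obtains d e where "d \<in> disjs g" "e \<in> conjs d" "x \<in> vars e"
  using assms Union_vars_disjs[of g] Union_vars_conjs by blast

lemma same_disj: "d \<in> disjs g \<Longrightarrow> d' \<in> disjs g \<Longrightarrow> x \<in> vars d \<Longrightarrow> x \<in> vars d' \<Longrightarrow> d = d'"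
  using disjs_disjoint[OF lin(3,4), of d d'] by auto

lemma other_conj_g:
  assumes "d \<in> disjs g" "e \<in> conjs d" obtains e' where "e' \<in> conjs d" "e' \<noteq> e"
  using other_conj[of d e] disj_g[OF assms(1)] disj2[OF assms(1)] assms(2) by metis

text \<open>Only the disjunct \<open>d\<close> containing \<open>x\<close> can notice that
  \<open>x\<close> becomes true, so it is \<open>d\<close> that turns true. The conjuncts of
  \<open>d\<close> other than \<open>e\<close> do not contain \<open>x\<close> and were true before.
  This is used to show that \<open>f\<close> implies some conjunct of \<open>d\<close>, against
  \<open>stuck2\<close>.\<close>

lemma sat_partner:
  assumes "d \<in> disjs g" "e \<in> conjs d" "x \<in> vars e" "sat (insert x P) g" "\<not> sat P g"
  shows "sat (insert x P) d" and "e' \<in> conjs d \<Longrightarrow> e' \<noteq> e \<Longrightarrow> sat P e'"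
proof -
  have xd: "x \<in> vars d" using conj_disj_g[OF assms(1,2)] assms(3) by auto
  obtain d' where d': "d' \<in> disjs g" "sat (insert x P) d'" using assms(4) sat_disjs by metis
  have "d' = d"
  proof (rule ccontr)
    assume "d' \<noteq> d"
    then have "x \<notin> vars d'" using same_disj[OF d'(1) assms(1)] xd by auto
    then have "sat P d'" using d'(2) sat_insert by auto
    then show False using d'(1) assms(5) sat_disjs by metis
  qed
  with d' show d: "sat (insert x P) d" by simp
  assume e': "e' \<in> conjs d" "e' \<noteq> e"
  then have "x \<notin> vars e'" using disjoint_g[OF assms(1,2)] assms(3) by auto
  then show "sat P e'" using d e'(1) sat_conjs[of _ d] sat_insert by auto
qed

text \<open>By \<open>disj2\<close> the disjunct is a conjunction of at least two parts with
  disjoint variables, and each part needs a true variable of its own.\<close>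

lemma sat_disj_vars:
  assumes "d \<in> disjs g" "sat P d" shows "\<exists>x y. x \<noteq> y \<and> x \<in> P \<inter> vars d \<and> y \<in> P \<inter> vars d"
proof -
  obtain e where e: "e \<in> conjs d" using conjs_nonempty[of d] by auto
  obtain e' where e': "e' \<in> conjs d" "e' \<noteq> e" by (rule other_conj_g[OF assms(1) e])
  have "sat P e" "sat P e'" using assms(2) e e'(1) sat_conjs[of P d] by auto
  moreover have l: "ufree e" "vars e \<subseteq> vars d" "ufree e'" "vars e' \<subseteq> vars d"
    using conj_disj_g[OF assms(1) e] conj_disj_g[OF assms(1) e'(1)] by auto
  ultimately obtain x y where xy: "x \<in> P \<inter> vars e" "y \<in> P \<inter> vars e'"
    using ufree_not_sat[of e P] ufree_not_sat[of e' P] by auto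
  then have "x \<noteq> y" using disjoint_g[OF assms(1) e e'] by auto
  then show ?thesis using xy l by auto
qed

lemma not_sat_single: "\<not> sat {x} g"
proof
  assume "sat {x} g"
  then obtain d where "d \<in> disjs g" "sat {x} d" using sat_disjs by metis
  from sat_disj_vars[OF this] show False by auto
qed

text \<open>\<open>stuck1\<close> only yields some set; by purity it contains \<open>vars d\<close>,
  and monotonicity carries the failure of \<open>g\<close> down to \<open>vars d\<close>.\<close>

lemma pure_not_sat: "c \<in> conjs f \<Longrightarrow> d \<in> disjs c \<Longrightarrow> pure d \<Longrightarrow> \<not> sat (vars d) g"
  using stuck1[of c d] sat_mono unfolding pure_def by blast

lemma disj_conj_f: "c \<in> conjs f \<Longrightarrow> d \<in> disjs c \<Longrightarrow> linear d \<and> ufree d \<and> disjs d = {d} \<and> vars d \<subseteq> vars c"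
  using disjs_props[of d c] conj_f[of c] by auto

lemma other_disj_f:
  assumes "c \<in> conjs f" "d \<in> disjs c" obtains d' where "d' \<in> disjs c" "d' \<noteq> d"
proof -
  have "linear c" "ufree c" "conjs c = {c}" using conj_f[OF assms(1)] by auto
  then show ?thesis using other_disj[of c d] conj2[OF assms(1)] assms(2) that by blast
qed

lemma disjoint_f:
  "c \<in> conjs f \<Longrightarrow> d \<in> disjs c \<Longrightarrow> d' \<in> disjs c \<Longrightarrow> d \<noteq> d' \<Longrightarrow> vars d \<inter> vars d' = {}"
  using disjs_disjoint[of c d d'] conj_f[of c] by auto

text \<open>Each branch ends with a conjunct of a disjunct of \<open>g\<close> that \<open>f\<close>
  implies, against \<open>stuck2\<close>. The disjuncts of \<open>f1\<close> are pure and one is a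
  single literal; this forces \<open>f2\<close> to have an impure disjunct and no literal among its
  disjuncts. Counting to seven then leaves the shapes \<open>y \<or> z\<close> for \<open>f1\<close>
  and \<open>d1 \<or> (r \<and> (s \<or> t))\<close> for \<open>f2\<close>, with \<open>d1\<close> a
  conjunction of two literals.\<close>

lemma no_two_conjs:
  assumes f: "conjs f = {f1, f2}" "f1 \<noteq> f2" and small: "card (vars f1) \<le> 3"
  shows False
proof -
  have f1: "f1 \<in> conjs f" and f2: "f2 \<in> conjs f" using f by auto
  have satf: "sat P f = (sat P f1 \<and> sat P f2)" for P using f sat_conjs[of P f] by auto
  have dis: "vars f1 \<inter> vars f2 = {}" using conjs_disjoint[OF lin(1,2) f1 f2 f(2)] .
  have "vars f1 \<union> vars f2 = vars f" using Union_vars_conjs[of f] f(1) by auto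
  then have csum: "card (vars f1) + card (vars f2) \<le> 7" using dis card7 card_Un_disjoint[of "vars f1" "vars f2"] by auto
  have pure1: "pure d" if d: "d \<in> disjs f1" for d
  proof -
    obtain d' where d': "d' \<in> disjs f1" "d' \<noteq> d" by (rule other_disj_f[OF f1 d])
    have "vars d \<inter> vars d' = {}" using disjoint_f[OF f1 d d'(1)] d'(2) by auto
    moreover have "vars d \<union> vars d' \<subseteq> vars f1" using disj_conj_f[OF f1] d d' by auto
    ultimately have "card (vars d) + card (vars d') \<le> card (vars f1)"
      using card_Un_disjoint[of "vars d" "vars d'"] card_mono[of "vars f1" "vars d \<union> vars d'"] by simp
    moreover have "1 \<le> card (vars d')" using disj_conj_f[OF f1 d'(1)] ufree_card_vars by auto
    ultimately show ?thesis using small disj_conj_f[OF f1 d] by (intro pure_small) auto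
  qed
  \<comment> \<open>One half of the disjunction \<open>f1\<close> has a single variable, as there
    are at most three in all.\<close>
  obtain x where x: "x \<in> vars f1" "sat {x} f1"
  proof -
    obtain p q where pq: "f1 = Or p q"
      using conj_f[OF f1] conj2[OF f1] conjs_not_And[OF f1] by (cases f1) auto
    then have lp: "linear p" "ufree p" "linear q" "ufree q" using conj_f[OF f1] by auto
    have "card (vars p) + card (vars q) \<le> 3" using small pq card_vars_Or[of p q] conj_f[OF f1] by auto
    then have "card (vars p) < 2 \<or> card (vars q) < 2" by arith
    then obtain z b where "p = lit z b \<or> q = lit z b" using ufree_literal lp by metis
    then have "z \<in> vars f1" "sat {z} f1" using pq by auto
    with that show ?thesis by blast
  qed
  have xg: "x \<in> vars g" using x(1) conj_f[OF f1] vars_eq by auto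
  obtain d e where de: "d \<in> disjs g" "e \<in> conjs d" "x \<in> vars e" by (rule locate[OF xg])
  obtain e' where e': "e' \<in> conjs d" "e' \<noteq> e" by (rule other_conj_g[OF de(1,2)])
  have xsat: "sat (insert x P) g" if "sat P f2" for P
  proof (rule fg)
    have "sat (insert x P) f1" by (rule sat_mono[OF x(2)]) auto
    moreover have "sat (insert x P) f2" using that by (rule sat_mono) auto
    ultimately show "sat (insert x P) f" using satf by simp
  qed
  \<comment> \<open>If all disjuncts of \<open>f2\<close> were pure, \<open>g\<close> would fail at
    each of their variable sets and hold once \<open>x\<close> is added, so \<open>f2\<close> would
    imply \<open>e'\<close>.\<close>
  have "\<exists>d2\<in>disjs f2. \<not> pure d2"
  proof (rule ccontr)
    assume "\<not> ?thesis"
    then have pure2: "pure c" if "c \<in> disjs f2" for c using that by blast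
    have "sat P e'" if "sat P f" for P
    proof -
      obtain c where c: "c \<in> disjs f2" "sat P c" using \<open>sat P f\<close> satf sat_disjs[of P f2] by auto
      have "sat (vars c) f2" using c(1) disj_conj_f[OF f2 c(1)] ufree_sat[of c] sat_disjs[of _ f2] by auto
      then have "sat (vars c) e'"
        using sat_partner(2)[OF de _ pure_not_sat[OF f2 c(1) pure2[OF c(1)]] e'] xsat by auto
      then show ?thesis using sat_mono pure2[OF c(1)] c(2) unfolding pure_def by blast
    qed
    then show False using stuck2[OF de(1) e'(1)] by auto
  qed
  then obtain d2 where d2: "d2 \<in> disjs f2" "\<not> pure d2" by auto
  \<comment> \<open>For such a \<open>w\<close> the roles swap: \<open>w\<close> lies in
    \<open>e'\<close>, and adding it to the minterms of the pure disjuncts of \<open>f1\<close>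
    shows that \<open>f1\<close> implies \<open>e\<close>.\<close>
  have nolit: "\<not> sat {w} f2" for w
  proof
    assume w: "sat {w} f2"
    have "sat {w} e'" using sat_partner(2)[OF de _ not_sat_single e'] xsat[OF w] by auto
    then have we': "w \<in> vars e'" using ufree_not_sat[of e' "{w}"] conj_disj_g[OF de(1) e'(1)] by auto
    have "sat P e" if "sat P f" for P
    proof -
      obtain c where c: "c \<in> disjs f1" "sat P c" using \<open>sat P f\<close> satf sat_disjs[of P f1] by auto
      have "sat (vars c) f1" using c(1) disj_conj_f[OF f1 c(1)] ufree_sat[of c] sat_disjs[of _ f1] by auto
      then have "sat (insert w (vars c)) f1" by (rule sat_mono) auto
      moreover have "sat (insert w (vars c)) f2" using w by (rule sat_mono) auto
      ultimately have "sat (insert w (vars c)) g" using satf fg by simp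
      then have "sat (vars c) e"
        using sat_partner(2)[OF de(1) e'(1) we' _ pure_not_sat[OF f1 c(1) pure1[OF c(1)]] de(2)] e'(2) by auto
      then show ?thesis using sat_mono pure1[OF c(1)] c(2) unfolding pure_def by blast
    qed
    then show False using stuck2[OF de(1,2)] by auto
  qed
  have big: "2 \<le> card (vars c)" if c: "c \<in> disjs f2" for c
  proof (rule ccontr)
    assume "\<not> ?thesis"
    then obtain w b where "c = lit w b" using ufree_literal[of c] disj_conj_f[OF f2 c] by force
    then have "sat {w} c" by simp
    then have "sat {w} f2" using c sat_disjs[of "{w}" f2] by blast
    then show False using nolit by simp
  qed
  have d2p: "linear d2" "ufree d2" "disjs d2 = {d2}" "vars d2 \<subseteq> vars f2" using disj_conj_f[OF f2 d2(1)] by auto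
  have c3: "3 \<le> card (vars d2)" using pure_small[OF d2p(1-3)] d2(2) by force
  obtain d1 where d1: "d1 \<in> disjs f2" "d1 \<noteq> d2" by (rule other_disj_f[OF f2 d2(1)])
  have d1p: "linear d1" "ufree d1" "disjs d1 = {d1}" "vars d1 \<subseteq> vars f2" using disj_conj_f[OF f2 d1(1)] by auto
  have dd: "vars d1 \<inter> vars d2 = {}" by (rule disjoint_f[OF f2 d1(1) d2(1) d1(2)])
  have cun: "card (vars d1 \<union> vars d2) = card (vars d1) + card (vars d2)" using dd by (simp add: card_Un_disjoint)
  have sub: "vars d1 \<union> vars d2 \<subseteq> vars f2" using d1p d2p by auto
  then have "card (vars d1) + card (vars d2) \<le> card (vars f2)" using cun card_mono[OF finite_vars, of _ f2] by metis
  \<comment> \<open>At least 2 + 2 + 3 variables among at most seven: all bounds are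
    equalities.\<close>
  then have cs: "card (vars f1) = 2" "card (vars d1) = 2" "card (vars d2) = 3" "card (vars f2) = 5"
    using c3 big[OF d1(1)] csum conj2[OF f1] by auto
  then have veq: "vars d1 \<union> vars d2 = vars f2" using sub cun by (intro card_subset_eq) auto
  have only: "c = d1 \<or> c = d2" if c: "c \<in> disjs f2" for c
  proof (rule ccontr)
    assume n: "\<not> ?thesis"
    have "vars c \<inter> vars d1 = {}" "vars c \<inter> vars d2 = {}"
      using disjoint_f[OF f2 c] n d1(1) d2(1) by auto
    then show False using veq disj_conj_f[OF f2 c] ufree_vars[of c] by auto
  qed
  have satf2: "sat P f2 = (sat P d1 \<or> sat P d2)" for P using sat_disjs[of P f2] only d1(1) d2(1) by auto
  have pd1: "pure d1" using pure_small[OF d1p(1-3)] cs by simp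
  have sd1: "sat P d1 = (vars d1 \<subseteq> P)" for P using pd1 ufree_sat[OF d1p(2)] by (auto simp: pure_def)
  obtain y z where yz: "vars f1 = {y, z}" "\<And>P. sat P f1 = (y \<in> P \<or> z \<in> P)"
  proof -
    obtain y z where "vars f1 = {y, z}" "disjs f1 = {f1} \<or> (\<forall>P. sat P f1 = (y \<in> P \<or> z \<in> P))"
      using two_variable_formula[of f1] conj_f[OF f1] cs(1) by metis
    moreover have "disjs f1 \<noteq> {f1}" using conj_disj_card[of f1 f f1] f1 cs(1) by auto
    ultimately show ?thesis using that by blast
  qed
  \<comment> \<open>By \<open>stuck1\<close>, \<open>g\<close> fails at \<open>{r, s}\<close> or at
    \<open>{r, t}\<close>; swapping \<open>s\<close> and \<open>t\<close> reduces the second case to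
    the first.\<close>
  have key: False if rst: "vars d2 = {r, s, t}" "\<And>P. sat P d2 = (r \<in> P \<and> (s \<in> P \<or> t \<in> P))"
    and ns: "\<not> sat {r, s} g" for r s t
  proof -
    \<comment> \<open>Adding \<open>w\<close> to \<open>vars d1\<close> or to \<open>{r, s}\<close>
      makes \<open>g\<close> true, so both sets satisfy every conjunct \<open>b'\<close> of
      \<open>a\<close> other than the one with \<open>w\<close>. Since \<open>f\<close> does not
      imply \<open>b'\<close>, the remaining minterm \<open>{r, t}\<close> of \<open>f2\<close>
      fails \<open>b'\<close>, which puts \<open>s\<close> into \<open>b'\<close>.\<close>
    have part: "s \<in> vars b' \<and> \<not> sat {r, t} b' \<and> sat (insert w {r, s}) a" 
      if w: "w \<in> {y, z}" and a: "a \<in> disjs g" "b \<in> conjs a" "w \<in> vars b" "b' \<in> conjs a" "b' \<noteq> b" for w a b b'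
    proof -
      have wsat: "sat (insert w P) g" if "sat P f2" for P
        using fg[of "insert w P"] satf yz(2) w sat_mono[OF that, of "insert w P"] by auto
      have 1: "sat (vars d1) b'"
        using sat_partner(2)[OF a(1-3) _ pure_not_sat[OF f2 d1(1) pd1] a(4,5)] wsat satf2 sd1 by auto
      have g2: "sat (insert w {r, s}) g" using wsat satf2 rst(2) by simp
      have 2: "sat {r, s} b'" using sat_partner(2)[OF a(1-3) g2 ns a(4,5)] .
      obtain P where P: "sat P f" "\<not> sat P b'" using stuck2[OF a(1,4)] by auto
      have "\<not> vars d1 \<subseteq> P" using 1 P(2) sat_mono by blast
      then have "r \<in> P" "s \<in> P \<or> t \<in> P" using P(1) satf satf2 sd1 rst(2) by auto
      moreover have "\<not> {r, s} \<subseteq> P" using 2 P(2) sat_mono by blast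
      ultimately have "{r, t} \<subseteq> P" by auto
      then have rt: "\<not> sat {r, t} b'" using P(2) sat_mono by blast
      have "s \<in> vars b'"
      proof (rule ccontr)
        assume "s \<notin> vars b'"
        then have "sat {r} b'" using 2 sat_insert[of s b' "{r}"] by (simp add: insert_commute)
        then show False using rt sat_mono[of "{r}" b' "{r, t}"] by auto
      qed
      then show ?thesis using rt sat_partner(1)[OF a(1-3) g2 ns] by auto
    qed
    have vg: "y \<in> vars g" "z \<in> vars g" using yz(1) conj_f[OF f1] vars_eq by auto
    obtain a b where ab: "a \<in> disjs g" "b \<in> conjs a" "y \<in> vars b" by (rule locate[OF vg(1)])
    obtain b' where b': "b' \<in> conjs a" "b' \<noteq> b" by (rule other_conj_g[OF ab(1,2)])
    obtain a2 c where ac: "a2 \<in> disjs g" "c \<in> conjs a2" "z \<in> vars c" by (rule locate[OF vg(2)])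
    obtain c' where c': "c' \<in> conjs a2" "c' \<noteq> c" by (rule other_conj_g[OF ac(1,2)])
    have sb: "s \<in> vars b'" "\<not> sat {r, t} b'" "sat (insert y {r, s}) a" using part[of y, OF _ ab b'] by auto
    have sc: "s \<in> vars c'" "sat (insert z {r, s}) a2" using part[of z, OF _ ac c'] by auto
    \<comment> \<open>\<open>s\<close> belongs to a single disjunct and to a single conjunct of it,
      so \<open>y\<close> and \<open>z\<close> share the disjunct \<open>a\<close> and there the
      conjunct \<open>b\<close>.\<close>
    have "a2 = a" using same_disj[OF ac(1) ab(1), of s] sb sc conj_disj_g[OF ac(1) c'(1)] conj_disj_g[OF ab(1) b'(1)] by auto
    note ac = ac[unfolded this] and c' = c'[unfolded this] and sc = sc[unfolded this]
    have "c' = b'" using disjoint_g[OF ab(1) b'(1) c'(1)] sb sc by auto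
    have "c = b"
    proof (rule ccontr)
      assume "c \<noteq> b"
      then have "s \<in> vars c" using part[of y, OF _ ab ac(2)] by auto
      then show False using disjoint_g[OF ab(1) ac(2) c'(1) c'(2)] sc(1) by auto
    qed
    \<comment> \<open>At \<open>{y, r, t}\<close> some disjunct of \<open>g\<close> is true; it is
      not \<open>a\<close>, because \<open>b'\<close> fails, so it is true at \<open>{r, t}\<close>
      already. This puts \<open>r\<close> outside \<open>a\<close>, and then \<open>y\<close> and
      \<open>z\<close> each satisfy \<open>b\<close> alone.\<close>
    have rt: "\<exists>h\<in>disjs g. h \<noteq> a \<and> sat {r, t} h"
    proof -
      have "sat {y, r, t} f" using satf yz(2) satf2 rst(2) by auto
      then obtain h where h: "h \<in> disjs g" "sat (insert y {r, t}) h" using fg[of "{y, r, t}"] sat_disjs[of _ g] by auto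
      have "h \<noteq> a"
      proof
        assume "h = a"
        then have "sat (insert y {r, t}) b'" using h(2) b'(1) sat_conjs[of _ a] by auto
        moreover have "y \<notin> vars b'" using disjoint_g[OF ab(1,2) b'] ab(3) by auto
        ultimately show False using sb(2) sat_insert by auto
      qed
      moreover have "y \<notin> vars h" using same_disj[OF h(1) ab(1), of y] \<open>h \<noteq> a\<close> ab conj_disj_g[OF ab(1,2)] by auto
      ultimately show ?thesis using h sat_insert by auto
    qed
    then obtain h where h: "h \<in> disjs g" "h \<noteq> a" "sat {r, t} h" by auto
    have rh: "r \<in> vars h" using sat_disj_vars[OF h(1,3)] by auto
    then have ra: "r \<notin> vars a" using same_disj[OF h(1) ab(1)] h(2) by auto
    have "sat {w} b" if "sat (insert w {r, s}) a" for w
    proof -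
      have "sat (insert w {r, s}) b" using that ab(2) sat_conjs[of _ a] by auto
      moreover have "r \<notin> vars b" using ra conj_disj_g[OF ab(1,2)] by auto
      moreover have "s \<notin> vars b" using disjoint_g[OF ab(1,2) b'] sb(1) by auto
      ultimately show ?thesis using sat_cong[of "insert w {r, s}" b "{w}"] by auto
    qed
    then have "sat {y} b" "sat {z} b" using sb(3) sc(2) by auto
    then have "sat P b" if "sat P f" for P
      using that satf yz(2) sat_mono[of "{y}" b P] sat_mono[of "{z}" b P] by auto
    then show False using stuck2[OF ab(1,2)] by auto
  qed
  obtain r s t where rst: "vars d2 = {r, s, t}" "\<And>P. sat P d2 = (r \<in> P \<and> (s \<in> P \<or> t \<in> P))"
    using impure_three[OF d2p(1-3) cs(3) d2(2)] by metis
  obtain P where P: "sat P d2" "\<not> sat P g" using stuck1[OF f2 d2(1)] by auto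
  then have "{r, s} \<subseteq> P \<or> {r, t} \<subseteq> P" using rst(2) by auto
  then have "\<not> sat {r, s} g \<or> \<not> sat {r, t} g" using P(2) sat_mono by blast
  then show False using key[OF rst] key[of r t s] rst by (auto simp: insert_commute)
qed

text \<open>Up to renaming, \<open>c\<close> is \<open>x \<or> y\<close>,
  \<open>x \<or> (y \<and> z)\<close> or \<open>x \<or> y \<or> z\<close>. Taking
  \<open>y = z\<close> covers the first and, with one variable dropped, the last, where the freedom
  serves to retain a variable outside \<open>B\<close>. In the middle case \<open>stuck1\<close>
  makes \<open>g\<close> fail at \<open>{y, z}\<close>.\<close>

lemma triple_shape:
  assumes c: "c \<in> conjs f" "card (vars c) \<le> 3" and B: "sat (-B) f"
  obtains x y z where "x \<noteq> y" "x \<noteq> z" "{x, y, z} \<subseteq> vars c" "\<not> {x, y} \<subseteq> B" "\<not> {x, z} \<subseteq> B"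
    "\<forall>P. x \<in> P \<or> y \<in> P \<and> z \<in> P \<longrightarrow> sat P c" "y = z \<or> \<not> sat {y, z} g"
proof -
  note result = that
  have Bc: "sat (-B) c" using B c(1) sat_conjs[of _ f] by auto
  have l: "linear c" "ufree c" using conj_f[OF c(1)] by auto
  show ?thesis
  proof (cases "card (vars c) = 2")
    case True
    obtain x y where xy: "x \<noteq> y" "vars c = {x, y}" "disjs c = {c} \<or> (\<forall>P. sat P c = (x \<in> P \<or> y \<in> P))"
      using two_variable_formula[OF l True] by metis
    moreover have "disjs c \<noteq> {c}" using conj_disj_card[of c f c] c True by auto
    ultimately show ?thesis using result[of x y y] Bc by auto
  next
    case False
    then have c3: "card (vars c) = 3" using c(2) conj2[OF c(1)] by auto
    have *: thesis if pq: "card (vars p) = 1" "card (vars q) = 2" "linear p" "linear q" "ufree p" "ufree q"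
      "vars p \<inter> vars q = {}" "vars c = vars p \<union> vars q" "\<And>P. sat P c = (sat P p \<or> sat P q)" "disjs q \<subseteq> disjs c" for p q
    proof -
      obtain x b where p: "p = lit x b" using ufree_literal[of p] pq by auto
      obtain y z where yz: "y \<noteq> z" "vars q = {y, z}"
        "disjs q = {q} \<and> (\<forall>P. sat P q = (y \<in> P \<and> z \<in> P)) \<or> (\<forall>P. sat P q = (y \<in> P \<or> z \<in> P))"
        using two_variable_formula[of q] pq by metis
      have d: "x \<noteq> y" "x \<noteq> z" using pq(7) p yz by auto
      have v: "{x, y, z} \<subseteq> vars c" using pq(8) p yz by auto
      have sc: "sat P c = (x \<in> P \<or> sat P q)" for P using pq(9) p by simp
      from yz(3) show thesis
      proof
        assume q: "disjs q = {q} \<and> (\<forall>P. sat P q = (y \<in> P \<and> z \<in> P))"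
        then obtain P where "sat P q" "\<not> sat P g" using stuck1[OF c(1), of q] pq(10) by auto
        then have "\<not> sat {y, z} g" using q sat_mono[of "{y, z}" g P] by auto
        then show thesis using result[of x y z] d v sc q Bc by auto
      next
        assume q: "\<forall>P. sat P q = (y \<in> P \<or> z \<in> P)"
        show thesis
        proof (cases "x \<in> B")
          case False
          then show thesis using result[of x y y] d v sc q by auto
        next
          case x: True
          show thesis
          proof (cases "y \<in> B")
            case False
            then show thesis using result[of y z z] yz(1) v sc q by auto
          next
            case True
            then have "z \<notin> B" using Bc sc q x by auto
            then show thesis using result[of z x x] d v sc q by auto
          qed
        qed
      qed
    qed
    obtain p q where pq: "c = Or p q"
      using conj_f[OF c(1)] c3 conjs_not_And[OF c(1)] by (cases c) auto
    have "card (vars p) + card (vars q) = 3" "1 \<le> card (vars p)" "1 \<le> card (vars q)"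
      using card_vars_Or[of p q] l c3 pq ufree_card_vars by auto
    then have "card (vars p) = 1 \<and> card (vars q) = 2 \<or> card (vars p) = 2 \<and> card (vars q) = 1" by arith
    then show ?thesis
    proof
      assume "card (vars p) = 1 \<and> card (vars q) = 2"
      then show ?thesis using l pq by (intro *[of p q]) auto
    next
      assume "card (vars p) = 2 \<and> card (vars q) = 1"
      then show ?thesis using l pq by (intro *[of q p]) auto
    qed
  qed
qed

lemma pair_shape:
  assumes c: "c \<in> conjs f" "card (vars c) = 2"
  obtains x y where "x \<noteq> y" "vars c = {x, y}" "\<forall>P. sat P c = (x \<in> P \<or> y \<in> P)"
proof -
  obtain x y where "x \<noteq> y" "vars c = {x, y}" "disjs c = {c} \<or> (\<forall>P. sat P c = (x \<in> P \<or> y \<in> P))"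
    using two_variable_formula[of c] conj_f[OF c(1)] c(2) by metis
  moreover have "disjs c \<noteq> {c}" using conj_disj_card[of c f c] c by auto
  ultimately show ?thesis using that by blast
qed

lemma finite_conjs_f: "finite (conjs f)"
proof -
  have "finite (conjs a)" for a by (induction a) auto
  then show ?thesis .
qed

lemma sum_card_conjs: "(\<Sum>c\<in>conjs f. card (vars c)) \<le> 7"
proof -
  have "(\<Sum>c\<in>conjs f. card (vars c)) = card (\<Union>c\<in>conjs f. vars c)"
    using conjs_disjoint[OF lin(1,2)] by (intro card_UN_disjoint[symmetric] finite_conjs_f) auto
  then show ?thesis using card7 Union_vars_conjs[of f] by simp
qed

text \<open>With at least two variables each there are at most three conjuncts, and a conjunction at
  the root gives more than one. Of two conjuncts, one would have at most three variables, against
  \<open>no_two_conjs\<close>.\<close>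

lemma three_conjs:
  assumes "f = And a b"
  obtains c1 c2 c3 where "conjs f = {c1, c2, c3}" "c1 \<noteq> c2" "c1 \<noteq> c3" "c2 \<noteq> c3"
    "card (vars c1) = 2" "card (vars c2) = 2" "card (vars c3) \<le> 3"
proof -
  have "2 * card (conjs f) \<le> (\<Sum>c\<in>conjs f. card (vars c))"
    using sum_bounded_below[of "conjs f" 2 "\<lambda>c. card (vars c)"] conj2 by (simp add: mult.commute)
  then have le: "card (conjs f) \<le> 3" using sum_card_conjs by simp
  have "card (conjs f) \<noteq> 0" using conjs_nonempty[of f] finite_conjs_f by simp
  moreover have "card (conjs f) \<noteq> 1"
  proof
    assume "card (conjs f) = 1"
    then obtain c where c: "conjs f = {c}" by (auto simp: card_1_singleton_iff)
    obtain p q where pq: "p \<in> conjs a" "q \<in> conjs b" using conjs_nonempty[of a] conjs_nonempty[of b] by auto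
    then have "p = c" "q = c" using c assms by auto
    then have "vars c \<subseteq> vars a" "vars c \<subseteq> vars b" "ufree c"
      using conjs_props[OF pq(1)] conjs_props[OF pq(2)] lin assms by auto
    then show False using lin(1) assms ufree_vars[of c] by auto
  qed
  moreover have "card (conjs f) \<noteq> 2"
  proof
    assume "card (conjs f) = 2"
    then obtain c1 c2 where c: "conjs f = {c1, c2}" "c1 \<noteq> c2" by (auto simp: card_2_iff)
    then have "card (vars c1) + card (vars c2) \<le> 7" using sum_card_conjs by simp
    then have "card (vars c1) \<le> 3 \<or> card (vars c2) \<le> 3" by arith
    then show False using no_two_conjs[of c1 c2] no_two_conjs[of c2 c1] c by auto
  qed
  ultimately have "card (conjs f) = 3" using le by arith
  then obtain c1 c2 c3 where c: "conjs f = {c1, c2, c3}" "c1 \<noteq> c2" "c1 \<noteq> c3" "c2 \<noteq> c3"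
    by (auto simp: card_3_iff)
  have s: "card (vars c1) + card (vars c2) + card (vars c3) \<le> 7" using sum_card_conjs c by simp
  have g: "2 \<le> card (vars c1)" "2 \<le> card (vars c2)" "2 \<le> card (vars c3)" using conj2 c(1) by auto
  from s g consider "card (vars c1) = 2 \<and> card (vars c2) = 2 \<and> card (vars c3) \<le> 3"
    | "card (vars c1) = 2 \<and> card (vars c3) = 2 \<and> card (vars c2) \<le> 3"
    | "card (vars c3) = 2 \<and> card (vars c2) = 2 \<and> card (vars c1) \<le> 3" by linarith
  then show ?thesis
  proof cases
    case 1 then show ?thesis using that[of c1 c2 c3] c by auto
  next
    case 2 then show ?thesis using that[of c1 c3 c2] c by auto
  next
    case 3 then show ?thesis using that[of c3 c2 c1] c by auto
  qed
qed

lemma contradiction: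
  assumes "f = And f1 f2" "g = Or g1 g2"
  shows False
proof -
  interpret d: stuck_inference "neg g" "neg f" by (rule dual)
  obtain c1 c2 c3 where c: "conjs f = {c1, c2, c3}" "c1 \<noteq> c2" "c1 \<noteq> c3" "c2 \<noteq> c3"
    "card (vars c1) = 2" "card (vars c2) = 2" "card (vars c3) \<le> 3" by (rule three_conjs[OF assms(1)])
  have "neg g = And (neg g1) (neg g2)" using assms(2) by simp
  then obtain e1 e2 e3 where e: "conjs (neg g) = {e1, e2, e3}" "e1 \<noteq> e2" "e1 \<noteq> e3" "e2 \<noteq> e3"
    "card (vars e1) = 2" "card (vars e2) = 2" "card (vars e3) \<le> 3" by (rule d.three_conjs)
  have cs: "c1 \<in> conjs f" "c2 \<in> conjs f" "c3 \<in> conjs f" using c(1) by auto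
  have es: "e1 \<in> conjs (neg g)" "e2 \<in> conjs (neg g)" "e3 \<in> conjs (neg g)" using e(1) by auto
  obtain x1 y1 where 1: "x1 \<noteq> y1" "vars c1 = {x1, y1}" "\<forall>P. sat P c1 = (x1 \<in> P \<or> y1 \<in> P)"
    by (rule pair_shape[OF cs(1) c(5)])
  obtain x2 y2 where 2: "x2 \<noteq> y2" "vars c2 = {x2, y2}" "\<forall>P. sat P c2 = (x2 \<in> P \<or> y2 \<in> P)"
    by (rule pair_shape[OF cs(2) c(6)])
  have full: "sat (-{}) f" using ufree_sat[OF lin(2)] by simp
  obtain p q r where 3: "p \<noteq> q" "p \<noteq> r" "{p, q, r} \<subseteq> vars c3"
    "\<forall>P. p \<in> P \<or> q \<in> P \<and> r \<in> P \<longrightarrow> sat P c3" "q = r \<or> \<not> sat {q, r} g"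
    by (rule triple_shape[OF cs(3) c(7) full])
  have nqr: "\<not> sat {q, r} g" using 3(5) not_sat_single[of q] by auto
  obtain u1 v1 where 4: "u1 \<noteq> v1" "vars e1 = {u1, v1}" "\<forall>P. sat P e1 = (u1 \<in> P \<or> v1 \<in> P)"
    by (rule d.pair_shape[OF es(1) e(5)])
  obtain u2 v2 where 5: "u2 \<noteq> v2" "vars e2 = {u2, v2}" "\<forall>P. sat P e2 = (u2 \<in> P \<or> v2 \<in> P)"
    by (rule d.pair_shape[OF es(2) e(6)])
  \<comment> \<open>\<open>g\<close> fails at \<open>{q, r}\<close>, so the triple on the dual side
    can be chosen with neither \<open>{u, v}\<close> nor \<open>{u, w}\<close> inside
    \<open>{q, r}\<close>.\<close>
  have avoid: "sat (-{q, r}) (neg g)" using nqr by (simp add: sat_neg)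
  obtain u v w where 6: "u \<noteq> v" "u \<noteq> w" "{u, v, w} \<subseteq> vars e3" "\<not> {u, v} \<subseteq> {q, r}" "\<not> {u, w} \<subseteq> {q, r}"
    "\<forall>P. u \<in> P \<or> v \<in> P \<and> w \<in> P \<longrightarrow> sat P e3" "v = w \<or> \<not> sat {v, w} (neg f)"
    by (rule d.triple_shape[OF es(3) e(7) avoid])
  have satf: "sat P f \<longleftrightarrow> sat P c1 \<and> sat P c2 \<and> sat P c3" for P
    using sat_conjs[of P f] unfolding c(1) by blast
  have satg: "sat P g \<longleftrightarrow> \<not> sat (-P) e1 \<or> \<not> sat (-P) e2 \<or> \<not> sat (-P) e3" for P
    using sat_conjs[of "-P" "neg g"] sat_neg[of "-P" g] unfolding e(1) double_complement by blast
  \<comment> \<open>\<open>g\<close> is true where one of the three conjuncts of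
    \<open>neg g\<close> fails at the complement, and this forces one of four pairs into
    \<open>P\<close>.\<close>
  have G: "{u1, v1} \<subseteq> P \<or> {u2, v2} \<subseteq> P \<or> {u, v} \<subseteq> P \<or> {u, w} \<subseteq> P" if "sat P g" for P
    using that satg[of P] 4(3)[rule_format, of "-P"] 5(3)[rule_format, of "-P"] 6(6)[rule_format, of "-P"] by auto
  \<comment> \<open>Eight sets suffice for \<open>f\<close>, hence for \<open>g\<close>: one
    variable from each small conjunct, together with \<open>p\<close> or with both \<open>q\<close>
    and \<open>r\<close>.\<close>
  have F: "sat {s, t, p} g \<and> sat {s, t, q, r} g" if st: "s \<in> {x1, y1}" "t \<in> {x2, y2}" for s t
  proof -
    have "sat P f" if "s \<in> P" "t \<in> P" "p \<in> P \<or> q \<in> P \<and> r \<in> P" for P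
      using st that 1(3)[rule_format, of P] 2(3)[rule_format, of P] 3(4)[rule_format, of P] unfolding satf by blast
    then show ?thesis using fg by simp
  qed
  have dj: "vars c1 \<inter> vars c2 = {}" "vars c1 \<inter> vars c3 = {}" "vars c2 \<inter> vars c3 = {}"
    using conjs_disjoint[OF lin(1,2)] cs c(2-4) by blast+
  have ej: "vars e1 \<inter> vars e2 = {}" "vars e1 \<inter> vars e3 = {}" "vars e2 \<inter> vars e3 = {}"
    using conjs_disjoint[OF d.lin(1,2)] es e(2-4) by blast+
  have vw: "{v, w} \<noteq> {x1, y1} \<and> {v, w} \<noteq> {x2, y2}"
  proof (cases "v = w")
    case False
    then have "sat (-{v, w}) f" using 6(7) by (simp add: sat_neg)
    then show ?thesis using 1(3)[rule_format, of "-{v, w}"] 2(3)[rule_format, of "-{v, w}"] unfolding satf by blast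
  qed (use 1(1) 2(1) in \<open>auto simp: doubleton_eq_iff\<close>)
  have qr: "{q, r} \<noteq> {u1, v1}" "{q, r} \<noteq> {u2, v2}"
    using nqr satg[of "{q, r}"] 4(3)[rule_format, of "-{q, r}"] 5(3)[rule_format, of "-{q, r}"] by blast+
  have nc: "x1 \<noteq> x2" "x1 \<noteq> y2" "y1 \<noteq> x2" "y1 \<noteq> y2" "p \<notin> {x1, y1, x2, y2}" "q \<notin> {x1, y1, x2, y2}" "r \<notin> {x1, y1, x2, y2}"
    using dj 3(3) unfolding 1(2) 2(2) by auto
  have ne: "u1 \<noteq> u2" "u1 \<noteq> v2" "v1 \<noteq> u2" "v1 \<noteq> v2" "u \<notin> {u1, v1, u2, v2}" "v \<notin> {u1, v1, u2, v2}" "w \<notin> {u1, v1, u2, v2}"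
    using ej 6(3) unfolding 4(2) 5(2) by auto
  have uv: "{q, r} \<noteq> {u, v}" "{q, r} \<noteq> {u, w}" using 6(4,5) by auto
  show False
    by (rule pairs_miss_minterm[OF 1(1) 2(1) nc 3(1,2) 4(1) 5(1) ne 6(1,2) G F qr uv vw[THEN conjunct1] vw[THEN conjunct2]])
qed

end

lemma switch_condition:
  assumes "linear f" "ufree f" "linear g" "ufree g" "vars f = vars g" "card (vars f) \<le> 7"
    and "f = And f1 f2" "g = Or g1 g2"
    and "\<And>c. c \<in> conjs f \<Longrightarrow> 2 \<le> card (vars c)"
    and "\<And>d. d \<in> disjs g \<Longrightarrow> 2 \<le> card (vars d)"
    and "\<And>P. sat P f \<Longrightarrow> sat P g"
  shows "(\<exists>c\<in>conjs f. \<exists>d\<in>disjs c. \<forall>P. sat P d \<longrightarrow> sat P g) \<or>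
    (\<exists>d\<in>disjs g. \<exists>e\<in>conjs d. \<forall>P. sat P f \<longrightarrow> sat P e)"
proof (rule ccontr)
  assume n: "\<not> ?thesis"
  have stuck: "\<exists>P. sat P d \<and> \<not> sat P g" if "c \<in> conjs f" "d \<in> disjs c" for c d
    using n that by blast
  have stuck': "\<exists>P. sat P f \<and> \<not> sat P e" if "d \<in> disjs g" "e \<in> conjs d" for d e
    using n that by blast
  have "stuck_inference f g" by (rule stuck_inference.intro[OF assms(1-6) assms(9-11) stuck stuck'])
  then show False using assms(7,8) by (rule stuck_inference.contradiction)
qed

section \<open>At most seven common variables\<close>

lemma linear_inference_sat:
  assumes "linear_inference a b" "linear c" "lits a \<subseteq> lits c" "lits b \<subseteq> lits c" "sat P a"
  shows "sat P b"
  using inference_sat[OF assms(3,4) linear_lits[OF assms(2)]] assms(1,5)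
  by (auto simp: linear_inference_def)

lemma linear_inference_satI:
  assumes "linear a" "linear b" "linear c" "lits a \<subseteq> lits c" "lits b \<subseteq> lits c"
    "\<And>P. sat P a \<Longrightarrow> sat P b"
  shows "linear_inference a b"
  using inference_sat[OF assms(4,5) linear_lits[OF assms(3)]] assms
  by (auto simp: linear_inference_def)

text \<open>The induction hypothesis in a form that the reductions can take as an assumption.
  Variables are counted on both sides, so removing one that occurs on a single side is progress as
  well.\<close>

definition derivable_below :: "nat \<Rightarrow> bool" where
  "derivable_below n \<longleftrightarrow> (\<forall>a b. linear_inference a b \<longrightarrow> card (vars a \<inter> vars b) \<le> 7 \<longrightarrow>
     card (vars a) + card (vars b) < n \<longrightarrow> deriv_on (vars a \<union> vars b) a b)"

lemma derivable_belowD: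
  assumes "derivable_below n" "linear_inference a b" "vars a = V" "vars b = V" "card V \<le> 7" "2 * card V < n"
  shows "deriv_on V a b"
proof -
  have "card (vars a \<inter> vars b) \<le> 7" "card (vars a) + card (vars b) < n" using assms by auto
  then have "deriv_on (vars a \<union> vars b) a b" using assms(1,2) unfolding derivable_below_def by blast
  then show ?thesis using assms(3,4) by simp
qed

text \<open>After \<open>deriv_on_split\<close> each half is an inference on strictly fewer
  variables, because the other half of the conclusion is unit-free. This is why \<open>n\<close> may
  equal \<open>2 * card (vars a)\<close>.\<close>

lemma deriv_on_to_And:
  assumes IH: "derivable_below n" and inf: "linear_inference a (And b1 b2)"
    and v: "vars a = vars b1 \<union> vars b2" "card (vars a) \<le> 7" and u: "ufree b1" "ufree b2"
    and n: "2 * card (vars a) \<le> n"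
  shows "deriv_on (vars a) a (And b1 b2)"
proof -
  have lin: "linear a" "linear b1" "linear b2" "vars b1 \<inter> vars b2 = {}"
    using inf by (auto simp: linear_inference_def)
  have c: "card (vars a) = card (vars b1) + card (vars b2)"
    using v lin by (simp add: card_Un_disjoint)
  have *: "deriv_on (vars b) (keep (vars b) Top a) b" if b: "b \<in> {b1, b2}" for b
  proof -
    have "linear_inference a b" using inf b lin by (auto simp: linear_inference_def)
    then have "linear_inference (keep (vars b) Top a) (keep (vars b) Bot b)"
      by (rule linear_inference_keep) (auto dest: lits_vars)
    then have i: "linear_inference (keep (vars b) Top a) b" by (simp add: keep_id)
    have bv: "vars b \<subseteq> vars a" using b v by auto
    then have e: "vars (keep (vars b) Top a) = vars b" by auto
    have "card (vars b) < card (vars a)"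
      using b c ufree_card_vars[OF u(1)] ufree_card_vars[OF u(2)] by auto
    then show ?thesis using v(2) n by (intro derivable_belowD[OF IH i e]) auto
  qed
  have "deriv_on (vars a) a (And (keep (vars b1) Top a) (keep (vars b2) Top a))"
    using deriv_on_split[of a "vars b1" "vars b2"] lin v by auto
  also have "deriv_on (vars a) \<dots> (And b1 b2)"
    unfolding v(1) using lin * by (intro deriv_on_And) (auto intro: linear_keep)
  finally show ?thesis .
qed

lemma deriv_on_from_Or:
  assumes "derivable_below n" "linear_inference (Or a1 a2) b"
    "vars b = vars a1 \<union> vars a2" "card (vars b) \<le> 7" "ufree a1" "ufree a2" "2 * card (vars b) \<le> n"
  shows "deriv_on (vars b) (Or a1 a2) b"
  by (rule deriv_on_negI)
    (use deriv_on_to_And[of n "neg b" "neg a1" "neg a2"] linear_inference_neg[OF assms(2)] assms in simp)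

lemma eval_cong: "(\<And>x. x \<in> vars a \<Longrightarrow> \<alpha> x = \<beta> x) \<Longrightarrow> eval \<alpha> a = eval \<beta> a"
  by (induction a) auto

text \<open>The literal is set aside, the rest \<open>r\<close> derives \<open>b\<close> with that
  literal replaced by \<open>Top\<close>, on one variable fewer, and \<open>deriv_on_push\<close>
  returns the literal to its place.\<close>

lemma deriv_on_literal_conjunct:
  assumes IH: "derivable_below n" and inf: "linear_inference a b" and ab: "lits a = lits b"
    and u: "ufree a" "a \<noteq> lit x t" "lit x t \<in> conjs a"
    and n: "card (vars a) \<le> 7" "2 * card (vars a) \<le> n"
  shows "deriv_on (vars a) a b"
proof -
  have lin: "linear a" "linear b" using inf by (auto simp: linear_inference_def)
  have v: "vars a = vars b" using ab by (simp add: vars_lits)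
  have xa: "(x, t) \<in> lits a" using conjs_props[OF u(3)] by simp
  then have xv: "x \<in> vars a" by (rule lits_vars)
  obtain r where r: "acu a (And (lit x t) r)" "ufree r" "vars r = vars a - vars (lit x t)"
    by (rule conjs_extract[OF lin(1) u(1) u(3) u(2)])
  let ?b = "keep (-{x}) Top b"
  have "eval \<alpha> ?b" if "eval \<alpha> r" for \<alpha>
  proof -
    let ?\<alpha> = "\<alpha>(x := t)"
    have "eval ?\<alpha> r = eval \<alpha> r" using r(3) by (intro eval_cong) auto
    then have "eval ?\<alpha> r" using that by simp
    then have "eval ?\<alpha> a" using acu_eval[OF r(1), of ?\<alpha>] by (auto simp: lit_def)
    then have "eval ?\<alpha> b" using inf by (auto simp: linear_inference_def)
    moreover have "eval \<alpha> ?b = eval ?\<alpha> b"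
    proof (rule eval_keep_Top)
      fix y c assume "(y, c) \<in> lits b" "y \<notin> -{x}"
      then have "(x, c) \<in> lits b" "y = x" "(x, t) \<in> lits b" using xa ab by auto
      then show "?\<alpha> y = c" using linear_lits[OF lin(2), of x] by (cases c; cases t) simp_all
    qed auto
    ultimately show ?thesis by simp
  qed
  then have i: "linear_inference r ?b"
    using acu_linear[OF r(1)] lin by (auto simp: linear_inference_def intro: linear_keep)
  have e: "vars ?b = vars a - {x}" "vars r = vars a - {x}" using v r by auto
  have "card (vars a - {x}) < card (vars a)" using xv by (intro card_Diff1_less) auto
  then have "deriv_on (vars a - {x}) r ?b" using n by (intro derivable_belowD[OF IH i e(2) e(1)]) auto
  from deriv_on_And_r[OF this, of "lit x t"] have "deriv_on (vars a) (And (lit x t) r) (And (lit x t) ?b)"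
    using xv by (simp add: insert_absorb)
  moreover have "deriv_on (vars a) a (And (lit x t) r)"
    using r xv by (intro deriv_on_acu) auto
  moreover have "deriv_on (vars a) (And (lit x t) ?b) b"
    using deriv_on_push[OF lin(2)] xa ab v by auto
  ultimately show ?thesis using deriv_on_trans by metis
qed

text \<open>The switch keeps all variables, but it makes the root a disjunction, and
  \<open>deriv_on_from_Or\<close> then passes to smaller inferences.\<close>

lemma deriv_on_switch_conjunct:
  assumes IH: "derivable_below n" and inf: "linear_inference a b" and ab: "lits a = lits b"
    and u: "ufree a" and cd: "c \<in> conjs a" "c \<noteq> a" "d \<in> disjs c" "d \<noteq> c"
    and db: "\<And>P. sat P d \<Longrightarrow> sat P b"
    and n: "card (vars a) \<le> 7" "2 * card (vars a) \<le> n"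
  shows "deriv_on (vars a) a b"
proof -
  have lin: "linear a" "linear b" using inf by (auto simp: linear_inference_def)
  have v: "vars a = vars b" using ab by (simp add: vars_lits)
  have c: "linear c" "ufree c" "lits c \<subseteq> lits a" "vars c \<subseteq> vars a" using conjs_props[OF cd(1)] lin u by auto
  have d: "linear d" "ufree d" "lits d \<subseteq> lits a" "vars d \<subseteq> vars c" using disjs_props[OF cd(3)] c by auto
  obtain r where r: "acu a (And c r)" "ufree r" "vars r = vars a - vars c"
    by (rule conjs_extract[OF lin(1) u cd(1) cd(2)[symmetric]])
  obtain q where q: "acu c (Or d q)" "ufree q" "vars q = vars c - vars d"
    by (rule disjs_extract[OF c(1,2) cd(3) cd(4)[symmetric]])
  have l: "linear r" "linear q" "vars q \<inter> vars d = {}" "vars c \<inter> vars r = {}"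
    using acu_linear[OF r(1)] acu_linear[OF q(1)] by auto
  have l3: "linear (And r (Or q d))" using l d q(3) by auto
  have "acu a (And r c)"
    using l c by (intro acu.trans[OF r(1)] acu.and_comm) auto
  also have "acu (And r c) (And r (Or d q))" using q l c l3 by (intro acu.ctx_and_r) auto
  also have "acu (And r (Or d q)) (And r (Or q d))" using l3 by (intro acu.ctx_and_r acu.or_comm) auto
  finally have 1: "acu a (And r (Or q d))" .
  have V: "vars (Or (And r q) d) = vars a" using c d q(3) r(3) by auto
  have "deriv_on (vars a) a (And r (Or q d))" using V by (intro deriv_on_acu 1) auto
  also have "deriv_on (vars a) (And r (Or q d)) (Or (And r q) d)"
    using V l3 by (intro deriv_on_step step_switch) auto
  also have "deriv_on (vars a) (Or (And r q) d) b"
  proof -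
    have "linear_inference d b"
      using linear_inference_satI[OF d(1) lin(2) lin(1) d(3)] ab db by auto
    \<comment> \<open>\<open>r \<and> q\<close> implies \<open>a\<close> and hence \<open>b\<close>,
      while \<open>d\<close> implies \<open>b\<close> by assumption.\<close>
    then have "linear_inference (Or (And r q) d) b"
      using inf l3 acu_eval[OF 1] by (auto simp: linear_inference_def)
    moreover have "vars b = vars (And r q) \<union> vars d" using V v by simp
    ultimately have "deriv_on (vars b) (Or (And r q) d) b"
      using n v r q d by (intro deriv_on_from_Or[OF IH]) auto
    then show ?thesis using v by simp
  qed
  finally show ?thesis .
qed

lemma deriv_on_same_literals:
  assumes IH: "derivable_below n" and inf: "linear_inference a b" and ab: "lits a = lits b"
    and u: "ufree a" "ufree b" and n: "card (vars a) \<le> 7" "2 * card (vars a) \<le> n"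
  shows "deriv_on (vars a) a b"
proof -
  have lin: "linear a" "linear b" using inf by (auto simp: linear_inference_def)
  have v: "vars a = vars b" using ab by (simp add: vars_lits)
  have inf': "linear_inference (neg b) (neg a)" using inf by (rule linear_inference_neg)
  have ab': "lits (neg b) = lits (neg a)" using ab by (auto simp: lits_neg)
  have negI: "deriv_on (vars a) a b" if "deriv_on (vars (neg b)) (neg b) (neg a)"
    by (rule deriv_on_negI) (use that v in simp)
  show ?thesis
  proof (cases "card (vars a) < 2")
    case True
    then obtain x s y t where xy: "a = lit x s" "b = lit y t"
      using ufree_literal[OF u(1) lin(1)] ufree_literal[OF u(2) lin(2)] v by metis
    then have "a = b" using ab by simp
    then show ?thesis by simp
  next
    case False
    show ?thesis
    proof (cases "(\<exists>b1 b2. b = And b1 b2) \<or> (\<exists>a1 a2. a = Or a1 a2)")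
      case True
      then show ?thesis
      proof (elim disjE exE)
        fix b1 b2 assume "b = And b1 b2"
        then show ?thesis using inf u n v deriv_on_to_And[OF IH, of a b1 b2] by simp
      next
        fix a1 a2 assume "a = Or a1 a2"
        then show ?thesis using inf u n v deriv_on_from_Or[OF IH, of a1 a2 b] by simp
      qed
    next
      case nroot: False
      have sing: "card (vars (Var x)) < 2" "card (vars (NVar x)) < 2" for x by auto
      obtain a1 a2 where a: "a = And a1 a2" using nroot False u sing by (cases a) auto
      obtain b1 b2 where b: "b = Or b1 b2" using nroot False u sing v by (cases b) auto
      have aa: "c \<noteq> a" if "c \<in> conjs a" for c using conjs_not_And[OF that] a by auto
      have bb: "d \<noteq> b" if "d \<in> disjs b" for d using disjs_not_Or[OF that] b by auto
      show ?thesis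
      proof (cases "\<exists>c\<in>conjs a. card (vars c) < 2")
        case True
        then obtain c where c: "c \<in> conjs a" "card (vars c) < 2" by auto
        then obtain x t where "c = lit x t" using ufree_literal[of c] conjs_props[of c a] u lin by metis
        then show ?thesis using deriv_on_literal_conjunct[OF IH inf ab u(1) _ _ n] c aa by metis
      next
        case ca: False
        show ?thesis
        proof (cases "\<exists>d\<in>disjs b. card (vars d) < 2")
          case True
          then obtain d where d: "d \<in> disjs b" "card (vars d) < 2" by auto
          then obtain x t where xt: "d = lit x t" using ufree_literal[of d] disjs_props[of d b] u lin by metis
          have "lit x (\<not> t) \<in> conjs (neg b)" using d(1) xt unfolding conjs_neg
            by (auto simp: lit_def image_iff intro!: bexI[of _ d])
          moreover have "neg b \<noteq> lit x (\<not> t)" using b by (auto simp: lit_def)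
          ultimately show ?thesis
            using n v u by (intro negI deriv_on_literal_conjunct[OF IH inf' ab']) auto
        next
          case db: False
          have "sat P b" if "sat P a" for P
            using linear_inference_sat[OF inf lin(1)] ab that by auto
          then have "(\<exists>c\<in>conjs a. \<exists>d\<in>disjs c. \<forall>P. sat P d \<longrightarrow> sat P b) \<or>
            (\<exists>d\<in>disjs b. \<exists>e\<in>conjs d. \<forall>P. sat P a \<longrightarrow> sat P e)"
            using ca db by (intro switch_condition[OF lin(1) u(1) lin(2) u(2) v n(1) a b]) (auto simp: not_less)
          then show ?thesis
          proof (elim disjE bexE)
            fix c d assume cd: "c \<in> conjs a" "d \<in> disjs c" "\<forall>P. sat P d \<longrightarrow> sat P b"
            have "d \<noteq> c" using conj_disj_card[of c a c] cd ca by auto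
            then show ?thesis
              using deriv_on_switch_conjunct[OF IH inf ab u(1) cd(1) aa[OF cd(1)] cd(2) _ _ n] cd(3) by auto
          next
            fix d e assume de: "d \<in> disjs b" "e \<in> conjs d" "\<forall>P. sat P a \<longrightarrow> sat P e"
            have "e \<noteq> d" using conj_disj_card[of d d b] de db by auto
            then have "neg e \<noteq> neg d" using neg_neg by metis
            moreover have "neg d \<in> conjs (neg b)" "neg e \<in> disjs (neg d)"
              using de by (auto simp: conjs_neg disjs_neg)
            moreover have "neg d \<noteq> neg b" using bb[OF de(1)] neg_neg by metis
            ultimately show ?thesis
              using n v u de(3)
              by (intro negI deriv_on_switch_conjunct[OF IH inf' ab', of "neg d" "neg e"]) (auto simp: sat_neg)
          qed
        qed
      qed
    qed
  qed
qed

theorem deriv_on_inference: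
  assumes "linear_inference a b" "card (vars a \<inter> vars b) \<le> 7"
  shows "deriv_on (vars a \<union> vars b) a b"
  using assms
proof (induction "card (vars a) + card (vars b)" arbitrary: a b rule: less_induct)
  case less
  let ?V = "vars a \<union> vars b"
  have IH: "derivable_below (card (vars a) + card (vars b))"
    using less unfolding derivable_below_def by auto
  have lin: "linear a" "linear b" using less by (auto simp: linear_inference_def)
  obtain a' where a': "acu a a'" "lits a' \<subseteq> lits a" "a' = Top \<or> a' = Bot \<or> ufree a'"
    using unit_normal_form[OF lin(1)] by metis
  obtain b' where b': "acu b b'" "lits b' \<subseteq> lits b" "b' = Top \<or> b' = Bot \<or> ufree b'"
    using unit_normal_form[OF lin(2)] by metis
  have v: "vars a' \<subseteq> vars a" "vars b' \<subseteq> vars b" using a'(2) b'(2) by (auto simp: vars_lits)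
  have lin': "linear a'" "linear b'" using acu_linear a'(1) b'(1) by auto
  have inf: "linear_inference a' b'"
    using less.prems(1) lin' acu_eval[OF a'(1)] acu_eval[OF b'(1)] by (auto simp: linear_inference_def)
  have "deriv_on ?V a' b'"
  proof (cases "a' = Bot \<or> b' = Top")
    case True
    then show ?thesis
    proof
      assume "a' = Bot" then show ?thesis using deriv_on_Bot[of b' ?V] lin' v by auto
    next
      assume "b' = Top" then show ?thesis using deriv_on_Top[of a' ?V] lin' v by auto
    qed
  next
    case nt: False
    \<comment> \<open>The variables with the same polarity on both sides; all other literals can be
      replaced by units.\<close>
    define L where "L = {x. \<exists>c. (x, c) \<in> lits a' \<and> (x, c) \<in> lits b'}"
    have infL: "linear_inference (keep L Top a') (keep L Bot b')"
      using inf by (rule linear_inference_keep) (auto simp: L_def)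
    have La: "L \<subseteq> vars a'" "L \<subseteq> vars b'" by (auto simp: L_def dest: lits_vars)
    then have va: "vars (keep L Top a') = L" "vars (keep L Bot b') = L" by auto
    have "L \<subseteq> vars a \<inter> vars b" using La v by auto
    then have "card L \<le> card (vars a \<inter> vars b)" by (intro card_mono) auto
    then have cL: "card L \<le> 7" using less.prems(2) by simp
    show ?thesis
    proof (cases "L = vars a \<and> L = vars b")
      case False
      then have "L \<subset> vars a \<or> L \<subset> vars b" using La v by auto
      then have "card L < card (vars a) \<or> card L < card (vars b)"
        by (auto intro: psubset_card_mono)
      moreover have "card L \<le> card (vars a)" "card L \<le> card (vars b)"
        using La v by (auto intro!: card_mono)
      ultimately have "card L + card L < card (vars a) + card (vars b)"
        by linarith
      then have "deriv_on L (keep L Top a') (keep L Bot b')"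
        using cL by (intro derivable_belowD[OF IH infL va]) auto
      then have "deriv_on ?V (keep L Top a') (keep L Bot b')"
        using La v by (auto intro: deriv_on_mono)
      moreover have "deriv_on ?V a' (keep L Top a')" "deriv_on ?V (keep L Bot b') b'"
        using v by (auto intro!: deriv_on_mono[OF deriv_on_keep_Top[OF lin'(1)]]
            deriv_on_mono[OF deriv_on_keep_Bot[OF lin'(2)]])
      ultimately show ?thesis using deriv_on_trans by metis
    next
      case True
      \<comment> \<open>Nothing can be deleted here: every variable occurs on both sides with one
        polarity.\<close>
      have lits: "lits a' = lits b'"
      proof -
        have "(x, c) \<in> lits q" if "(x, c) \<in> lits p" "p \<in> {a', b'}" "q \<in> {a', b'}" for x c p q
        proof -
          have "x \<in> L" using that True v lits_vars by blast
          then obtain c' where "(x, c') \<in> lits a'" "(x, c') \<in> lits b'" by (auto simp: L_def)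
          then show ?thesis using that linear_lits[OF lin'(1), of x] linear_lits[OF lin'(2), of x]
            by (cases c; cases c') auto
        qed
        then show ?thesis by auto
      qed
      have V: "vars a' = L" "vars b' = L" using True La v by auto
      show ?thesis
      proof (cases "a' = Top")
        case True
        then have "b' = Bot \<or> ufree b'" "lits b' = {}" using nt b'(3) lits by auto
        then have "b' = Bot" using ufree_vars[of b'] by (auto simp: vars_lits)
        then show ?thesis using inf True by (auto simp: linear_inference_def)
      next
        case na: False
        then have u: "ufree a'" using nt a'(3) by auto
        have "ufree b'"
        proof (rule ccontr)
          assume "\<not> ufree b'"
          then have "lits a' = {}" using nt b'(3) lits by auto
          then show False using ufree_vars[OF u] by (auto simp: vars_lits)
        qed
        then have "deriv_on (vars a') a' b'"
          using True V cL deriv_on_same_literals[OF IH inf lits u] by auto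
        then show ?thesis by (rule deriv_on_mono) (use v in auto)
      qed
    qed
  qed
  moreover have "deriv_on ?V a a'" "deriv_on ?V b' b"
    using v by (auto intro!: deriv_on_acu a'(1) acu.sym[OF b'(1)])
  ultimately show ?case using deriv_on_trans by metis
qed

section \<open>An inference on eight variables\<close>

text \<open>\<open>x\<close> and \<open>y\<close> are joined if their lowest common ancestor is a conjunction.\<close>

fun joined :: "lform \<Rightarrow> nat \<Rightarrow> nat \<Rightarrow> bool" where
  "joined (And a b) x y \<longleftrightarrow> x \<in> vars a \<and> y \<in> vars b \<or> y \<in> vars a \<and> x \<in> vars b \<or> joined a x y \<or> joined b x y"
| "joined (Or a b) x y \<longleftrightarrow> joined a x y \<or> joined b x y"
| "joined _ x y \<longleftrightarrow> False"

text \<open>Unlike in \<open>sat\<close>, polarity counts: \<open>S\<close> is the set of variables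
  assigned true, as formulae within a derivation may contain negative literals.\<close>

definition holds :: "nat set \<Rightarrow> lform \<Rightarrow> bool" where
  "holds S a = eval (\<lambda>v. v \<in> S) a"

lemma holds_simps [simp]:
  "holds S Top" "\<not> holds S Bot" "holds S (Var x) \<longleftrightarrow> x \<in> S" "holds S (NVar x) \<longleftrightarrow> x \<notin> S"
  "holds S (And a b) \<longleftrightarrow> holds S a \<and> holds S b" "holds S (Or a b) \<longleftrightarrow> holds S a \<or> holds S b"
  by (auto simp: holds_def)

lemma joined_vars: "joined a x y \<Longrightarrow> x \<in> vars a \<and> y \<in> vars a"
  by (induction a) auto

lemma holds_insert: "x \<notin> vars a \<Longrightarrow> holds (insert x S) a = holds S a"
  by (induction a) auto

text \<open>At the conjunction where \<open>x\<close> and \<open>y\<close> meet, adding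
  \<open>x\<close> cannot affect the side of \<open>y\<close> and vice versa, so both sides are
  already true at \<open>S\<close>.\<close>

lemma joined_holds:
  "linear a \<Longrightarrow> joined a x y \<Longrightarrow> holds (insert x S) a \<Longrightarrow> holds (insert y S) a \<Longrightarrow> holds S a"
proof (induction a)
  case (And p q)
  have d: "z \<notin> vars q" if "z \<in> vars p" for z using And.prems(1) that by auto
  from And.prems(2) consider "x \<in> vars p" "y \<in> vars q" | "y \<in> vars p" "x \<in> vars q" | "joined p x y" | "joined q x y"
    by auto
  then show ?case
  proof cases
    case 1
    then have "y \<notin> vars p" "x \<notin> vars q" using d by auto
    then show ?thesis using And.prems holds_insert by auto
  next
    case 2
    then have "x \<notin> vars p" "y \<notin> vars q" using d by auto
    then show ?thesis using And.prems holds_insert by auto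
  next
    case 3
    then have "x \<notin> vars q" using d joined_vars by auto
    then show ?thesis using And 3 holds_insert by auto
  next
    case 4
    then have "x \<notin> vars p" using d joined_vars by auto
    then show ?thesis using And 4 holds_insert by auto
  qed
next
  case (Or p q)
  have d: "z \<notin> vars q" if "z \<in> vars p" for z using Or.prems(1) that by auto
  from Or.prems(2) consider "joined p x y" | "joined q x y" by auto
  then show ?case
  proof cases
    case 1
    then have "x \<notin> vars q" "y \<notin> vars q" using d joined_vars by auto
    then show ?thesis using Or 1 holds_insert by auto
  next
    case 2
    then have "x \<notin> vars p" "y \<notin> vars p" using d joined_vars by auto
    then show ?thesis using Or 2 holds_insert by auto
  qed
qed auto

lemma not_joined_holds:
  "linear a \<Longrightarrow> \<not> joined a x y \<Longrightarrow> x \<in> vars a \<Longrightarrow> y \<in> vars a \<Longrightarrow> x \<noteq> y \<Longrightarrow>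
    holds (insert x (insert y S)) a \<Longrightarrow> holds (insert x S) a \<or> holds (insert y S) a"
proof (induction a)
  case (And p q)
  have d: "z \<notin> vars q" if "z \<in> vars p" for z using And.prems(1) that by auto
  from And.prems consider "x \<in> vars p" "y \<in> vars p" | "x \<in> vars q" "y \<in> vars q" by auto
  then show ?case
  proof cases
    case 1
    then have "x \<notin> vars q" "y \<notin> vars q" using d by auto
    then show ?thesis using And 1 holds_insert by auto
  next
    case 2
    then have "x \<notin> vars p" "y \<notin> vars p" using d by auto
    then show ?thesis using And 2 holds_insert by auto
  qed
next
  case (Or p q)
  have d: "z \<notin> vars q" if "z \<in> vars p" for z using Or.prems(1) that by auto
  from Or.prems consider "x \<in> vars p" "y \<in> vars p" | "x \<in> vars q" "y \<in> vars q"
    | "x \<in> vars p" "y \<in> vars q" | "y \<in> vars p" "x \<in> vars q" by auto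
  then show ?case
  proof cases
    case 1
    then have "x \<notin> vars q" "y \<notin> vars q" using d by auto
    then show ?thesis using Or 1 holds_insert by auto
  next
    case 2
    then have "x \<notin> vars p" "y \<notin> vars p" using d by auto
    then show ?thesis using Or 2 holds_insert by auto
  next
    case 3
    then have "x \<notin> vars q" "y \<notin> vars p" using d by auto
    then show ?thesis using Or.prems holds_insert[of y p "S"] holds_insert[of y p "insert x S"]
        holds_insert[of x q "insert y S"] by (auto simp: insert_commute)
  next
    case 4
    then have "x \<notin> vars p" "y \<notin> vars q" using d by auto
    then show ?thesis using Or.prems holds_insert[of y q "insert x S"]
        holds_insert[of x p "insert y S"] by (auto simp: insert_commute)
  qed
qed auto

lemma holds_mono: "(x, False) \<notin> lits a \<Longrightarrow> holds S a \<Longrightarrow> holds (insert x S) a"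
  by (induction a) auto

lemma holds_antimono: "(x, True) \<notin> lits a \<Longrightarrow> holds (insert x S) a \<Longrightarrow> holds S a"
  by (induction a) auto

text \<open>If adding \<open>x\<close> once turns \<open>a\<close> true, \<open>x\<close> occurs
  positively; by linearity it has no negative occurrence, so \<open>a\<close> is monotone in
  \<open>x\<close>.\<close>

lemma positive_holds:
  assumes "linear a" "\<not> holds S a" "holds (insert x S) a" "holds T a"
  shows "holds (insert x T) a"
proof -
  have "(x, True) \<in> lits a" using holds_antimono assms by blast
  then show ?thesis using linear_lits[OF assms(1)] holds_mono assms(4) by blast
qed

lemma essential_vars: "\<not> holds S a \<Longrightarrow> holds (insert x S) a \<Longrightarrow> x \<in> vars a"
  using holds_insert by blast

text \<open>Switch only removes joined pairs, medial only adds some.\<close>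

lemma step_joined:
  "step SM a b \<Longrightarrow> (\<forall>x y. joined b x y \<longrightarrow> joined a x y) \<or> (\<forall>x y. joined a x y \<longrightarrow> joined b x y)"
proof (induction rule: step.induct)
  case (inst l r \<sigma>)
  then show ?case by (auto simp: switch_def medial_def)
next
  case (and_l a b c)
  then show ?case using step_vars[OF and_l(1)] by auto
next
  case (and_r a b c)
  then show ?case using step_vars[OF and_r(1)] by auto
qed auto

lemma derivable_units_eval:
  assumes "derivable_units SM a b" "eval \<alpha> a" shows "eval \<alpha> b"
  using assms(1) unfolding derivable_units_def
proof (induction rule: rtranclp_induct)
  case (step y z)
  then show ?case unfolding step_u_def using acu_eval step_eval by blast
qed (use assms(2) in simp)

section \<open>The example and the formulae between its two sides\<close>

definition phi8 :: lform where
  "phi8 = And (Or (And (Var 0) (Var 1)) (And (Var 2) (Var 3)))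
              (Or (And (Var 4) (Var 5)) (And (Var 6) (Var 7)))"

definition psi8 :: lform where
  "psi8 = Or (And (Var 0) (Var 7))
             (And (Or (And (Var 1) (Var 4)) (Var 3)) (Or (And (Var 2) (Var 6)) (Var 5)))"

text \<open>Each minterm of \<open>phi8\<close> contains one of \<open>psi8\<close>:
  \<open>{0,1,6,7}\<close> contains \<open>{0,7}\<close>, \<open>{0,1,4,5}\<close> contains
  \<open>{1,4,5}\<close>, \<open>{2,3,4,5}\<close> contains \<open>{3,5}\<close> and
  \<open>{2,3,6,7}\<close> contains \<open>{2,3,6}\<close>.\<close>

lemma linear_inference_phi8_psi8: "linear_inference phi8 psi8"
  by (auto simp: linear_inference_def phi8_def psi8_def)

text \<open>By soundness this covers every formula of a derivation from \<open>phi8\<close> to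
  \<open>psi8\<close>. Such a formula may have further variables, units and negative literals, so
  even the occurrence and polarity of variables are deduced from the two bounds.\<close>

locale between =
  fixes a :: lform
  assumes lin: "linear a" and above: "\<And>\<alpha>. eval \<alpha> phi8 \<Longrightarrow> eval \<alpha> a"
    and below: "\<And>\<alpha>. eval \<alpha> a \<Longrightarrow> eval \<alpha> psi8"
begin

lemma holds_above: "holds S phi8 \<Longrightarrow> holds S a"
  unfolding holds_def by (rule above)

lemma holds_below: "\<not> holds S psi8 \<Longrightarrow> \<not> holds S a"
  unfolding holds_def using below by blast

text \<open>Adding \<open>x\<close> to \<open>S\<close> turns \<open>a\<close> from false, because
  of \<open>psi8\<close>, to true, because of \<open>phi8\<close>.\<close>

lemma essential:
  assumes "holds (insert x S) phi8" "\<not> holds S psi8"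
  shows "x \<in> vars a" and "holds T a \<Longrightarrow> holds (insert x T) a"
  using essential_vars[of S a x] positive_holds[OF lin, of S x T] holds_above[OF assms(1)] holds_below[OF assms(2)] by blast+

lemma essential_between: "0 \<in> vars a" "1 \<in> vars a" "2 \<in> vars a" "3 \<in> vars a" "5 \<in> vars a" "7 \<in> vars a"
  using essential(1)[of 0 "{1,6,7}"] essential(1)[of 1 "{0,4,5}"] essential(1)[of 2 "{3,6,7}"]
    essential(1)[of 3 "{2,4,5}"] essential(1)[of 5 "{2,3,4}"] essential(1)[of 7 "{0,1,6}"]
  by (auto simp: phi8_def psi8_def)

lemma mono_between: "x \<in> {0, 1, 5} \<Longrightarrow> holds T a \<Longrightarrow> holds (insert x T) a"
  using essential(2)[of 0 "{1,6,7}"] essential(2)[of 1 "{0,4,5}"] essential(2)[of 5 "{2,3,4}"]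
  by (auto simp: phi8_def psi8_def)

text \<open>The set \<open>{2,3,4,6}\<close> falsifies \<open>phi8\<close> and satisfies
  \<open>psi8\<close>, so a derivation must change its status. This is the first of three
  implications that close a cycle with \<open>not_joined_12\<close> and \<open>not_holds\<close>. If
  \<open>3\<close> and \<open>7\<close> were not joined, one of them could be dropped from
  \<open>{2,3,4,6,7}\<close>, and dropping \<open>3\<close> falsifies \<open>psi8\<close>.\<close>

lemma joined_37:
  assumes "\<not> holds {2,3,4,6} a" shows "joined a 3 7"
proof (rule ccontr)
  assume n: "\<not> joined a 3 7"
  have "holds {3,7,2,4,6} a" by (rule holds_above) (simp add: phi8_def)
  then have "holds {3,2,4,6} a \<or> holds {7,2,4,6} a" using not_joined_holds[OF lin n] essential_between by auto
  moreover have "\<not> holds {7,2,4,6} a" by (rule holds_below) (simp add: psi8_def)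
  ultimately show False using assms by (simp add: insert_commute)
qed

text \<open>If \<open>1\<close> and \<open>2\<close> were joined as well, \<open>{0,3,4,6,7}\<close>
  and \<open>{0,3,4,5,6}\<close> would hold. The first shrinks to \<open>{0,4,6,7}\<close> because
  \<open>0\<close> and \<open>3\<close> are not joined, and grows to \<open>{0,4,5,6,7}\<close>. As
  \<open>3\<close> and \<open>7\<close> are joined, \<open>{0,4,5,6}\<close> would hold, which
  \<open>psi8\<close> forbids.\<close>

lemma not_joined_12:
  assumes "joined a 3 7" shows "\<not> joined a 1 2"
proof
  assume j: "joined a 1 2"
  have "holds {0,1,2,5,6,7} a" "holds {3,1,2,5,6,7} a" by (rule holds_above, simp add: phi8_def)+
  moreover have "\<not> holds {1,2,5,6,7} a" using holds_below[of "{1,2,5,6,7}"] by (auto simp: psi8_def)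
  ultimately have n: "\<not> joined a 0 3" using joined_holds[OF lin] by blast
  have "holds {1,0,3,4,6,7} a" "holds {2,0,3,4,6,7} a" by (rule holds_above, simp add: phi8_def)+
  then have "holds {0,3,4,6,7} a" using joined_holds[OF lin j] by blast
  then have "holds {0,4,6,7} a \<or> holds {3,4,6,7} a" using not_joined_holds[OF lin n] essential_between by auto
  moreover have "\<not> holds {3,4,6,7} a" using holds_below[of "{3,4,6,7}"] by (auto simp: psi8_def)
  ultimately have "holds {5,0,4,6,7} a" using mono_between[of 5] by auto
  then have "holds {7,0,4,5,6} a" by (simp add: insert_commute)
  moreover have "holds {1,0,3,4,5,6} a" "holds {2,0,3,4,5,6} a" by (rule holds_above, simp add: phi8_def)+
  then have "holds {0,3,4,5,6} a" using joined_holds[OF lin j] by blast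
  then have "holds {3,0,4,5,6} a" by (simp add: insert_commute)
  ultimately have "holds {0,4,5,6} a" using joined_holds[OF lin assms] by blast
  then show False using holds_below[of "{0,4,5,6}"] by (auto simp: psi8_def)
qed

text \<open>Otherwise monotonicity gives \<open>{0,1,2,3,4,6}\<close>. Since \<open>3\<close> and
  \<open>5\<close> are joined and \<open>{0,1,2,4,5,6}\<close> satisfies \<open>phi8\<close>, the
  set \<open>{0,1,2,4,6}\<close> would hold, and dropping \<open>1\<close> or \<open>2\<close> from
  it falsifies \<open>psi8\<close>.\<close>

lemma not_holds:
  assumes "\<not> joined a 1 2" shows "\<not> holds {2,3,4,6} a"
proof
  assume "holds {2,3,4,6} a"
  then have h: "holds {3,0,1,2,4,6} a" using mono_between[of 1 "{0,2,3,4,6}"] mono_between[of 0 "{2,3,4,6}"]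
    by (simp add: insert_commute)
  have j: "joined a 3 5"
  proof (rule ccontr)
    assume n: "\<not> joined a 3 5"
    have "holds {3,5,2,4} a" by (rule holds_above) (simp add: phi8_def)
    then have "holds {3,2,4} a \<or> holds {5,2,4} a" using not_joined_holds[OF lin n] essential_between by auto
    then show False using holds_below[of "{3,2,4}"] holds_below[of "{5,2,4}"] by (auto simp: psi8_def)
  qed
  have "holds {5,0,1,2,4,6} a" by (rule holds_above) (simp add: phi8_def)
  with h have "holds {0,1,2,4,6} a" using joined_holds[OF lin j] by blast
  then have "holds {1,2,0,4,6} a" by (simp add: insert_commute)
  then have "holds {1,0,4,6} a \<or> holds {2,0,4,6} a" using not_joined_holds[OF lin assms] essential_between by auto
  then show False using holds_below[of "{1,0,4,6}"] holds_below[of "{2,0,4,6}"] by (auto simp: psi8_def)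
qed

end

text \<open>For a formula in this interval, \<open>3\<close> and \<open>7\<close> are joined iff \<open>1\<close> and \<open>2\<close> are not; a switch or
  medial step moves all pairs in the same direction and hence can change neither.\<close>

lemma step_invariant:
  assumes "between a" "between b" "step SM a b" "\<not> holds {2,3,4,6} a"
  shows "\<not> holds {2,3,4,6} b"
proof -
  have j: "joined a 3 7" "\<not> joined a 1 2"
    using between.joined_37 between.not_joined_12 assms(1,4) by blast+
  from step_joined[OF assms(3)] have "joined b 3 7 \<or> \<not> joined b 1 2" using j by blast
  then show ?thesis using between.not_joined_12 between.not_holds assms(2) by blast
qed

lemma not_derivable_phi8_psi8: "\<not> derivable_units SM phi8 psi8"
proof
  have "\<not> (linear a \<and> (\<forall>\<alpha>. eval \<alpha> phi8 \<longrightarrow> eval \<alpha> a) \<and> \<not> holds {2,3,4,6} a)"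
    if "derivable_units SM a psi8" for a
    using that unfolding derivable_units_def
  proof (induction rule: converse_rtranclp_induct)
    case base
    show ?case by (simp add: psi8_def)
  next
    case (step a b)
    show ?case
    proof
      assume a: "linear a \<and> (\<forall>\<alpha>. eval \<alpha> phi8 \<longrightarrow> eval \<alpha> a) \<and> \<not> holds {2,3,4,6} a"
      \<comment> \<open>The rest of the derivation supplies this bound by soundness, so the
        induction carries only the bound by \<open>phi8\<close>.\<close>
      have below: "eval \<alpha> psi8" if "eval \<alpha> b" for \<alpha>
        using derivable_units_eval[of b psi8] step(2) that unfolding derivable_units_def by blast
      from step(1) show False
      proof
        assume "acu a b"
        then show False using acu_eval[of a b] acu_linear[of a b] a step(3) unfolding holds_def by blast
      next
        assume "step_u SM a b"
        then obtain a' b' where s: "acu a a'" "step SM a' b'" "acu b' b" by (auto simp: step_u_def)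
        have l: "linear a'" "linear b'" "linear b" using step_linear[OF s(2)] acu_linear[OF s(3)] by auto
        have e: "eval \<alpha> a' = eval \<alpha> a" "eval \<alpha> b' = eval \<alpha> b" for \<alpha> using acu_eval s by auto
        have "between a'" "between b'"
          using a l e below step_eval[OF s(2)] by (unfold_locales; blast)+
        then have "\<not> holds {2,3,4,6} b'" using step_invariant s(2) a e unfolding holds_def by blast
        then show False using step(3) a l e step_eval[OF s(2)] unfolding holds_def by blast
      qed
    qed
  qed
  moreover assume "derivable_units SM phi8 psi8"
  moreover have "linear phi8" "\<not> holds {2,3,4,6} phi8" by (auto simp: phi8_def)
  ultimately show False by blast
qed

theorem theorem2p9:
  shows "(\<forall>\<phi> \<psi>. linear_inference \<phi> \<psi> \<and> card (vars \<phi> \<inter> vars \<psi>) \<le> 7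
            \<longrightarrow> derivable_units {switch, medial} \<phi> \<psi>)
       \<and> (\<exists>\<phi> \<psi>. linear_inference \<phi> \<psi> \<and> vars \<phi> = vars \<psi> \<and> card (vars \<phi>) = 8
            \<and> \<not> derivable_units {switch, medial} \<phi> \<psi>)"
proof
  show "\<forall>\<phi> \<psi>. linear_inference \<phi> \<psi> \<and> card (vars \<phi> \<inter> vars \<psi>) \<le> 7
      \<longrightarrow> derivable_units {switch, medial} \<phi> \<psi>"
    using deriv_on_inference derivable_units_of_deriv_on by blast
  have "vars phi8 = {0..<8}" "vars psi8 = {0..<8}"
    by (auto simp: phi8_def psi8_def)
  then show "\<exists>\<phi> \<psi>. linear_inference \<phi> \<psi> \<and> vars \<phi> = vars \<psi> \<and> card (vars \<phi>) = 8
      \<and> \<not> derivable_units {switch, medial} \<phi> \<psi>"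
    using linear_inference_phi8_psi8 not_derivable_phi8_psi8 by (intro exI[of _ phi8] exI[of _ psi8]) simp
qed

end
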